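(* Let $j\ge1$ be an integer and $\alpha<-1$. Then there is a constant $C>0$ such that for all $f\in L^{4/3}(\mathbb{H},\mu_{\alpha,j})$ and all $\lambda>0$, $$\left|\{(z_1,z_2)\in\mathbb{H} : |P(f)(z_1,z_2)|>\lambda\}\right| \le \frac{C\,\|f\|^{4/3}_{L^{4/3}(\mathbb{H},\mu_{\alpha,j})}}{\lambda^{4/3}},$$ where $\mu_{\alpha,j}(z_1,z_2)=\left(|z_2|^{2}f_{\alpha,j}(z_2)\right)^{-1/3}$.
   Context: $\mathbb{H}=\{(z_1,z_2)\in\mathbb{C}^2:|z_1|<|z_2|<1\}$, $dV$ Lebesgue measure, $|U|$ Lebesgue measure of $U$. The Bergman projection is $P(f)(z)=\int_{\mathbb{H}}K_{\mathbb{H}}(z;\bar w)f(w)\,dV(w)$, $K_{\mathbb{H}}(z_1,z_2;\bar w_1,\bar w_2)=\frac{1}{\pi^2 z_2\bar w_2(1-\frac{z_1\bar w_1}{z_2\bar w_2})^2(1-z_2\bar w_2)^2}$. For a positive weight $\mu$, $\|f\|^p_{L^p(\mathbb{H},\mu)}=\int_{\mathbb{H}}|f|^p\mu\,dV$. For $z\in\mathbb{D}\setminus\{0\}$ define $h_1(z)=-\log|z|+1$ and $h_{k+1}(z)=\log(h_k(z)+1)+1$ for $k\ge1$, and $f_{\alpha,j}(z)=|z|^{-2}h_j(z)^{\alpha}\prod_{k=1}^{j-1}h_k(z)^{-1}$ (empty product equal to $1$). *)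

theory Defs
  imports "HOL-Analysis.Analysis"
begin

definition hartogs :: "(complex \<times> complex) set" where
  "hartogs = {(z1, z2). cmod z1 < cmod z2 \<and> cmod z2 < 1}"

definition hartogs_kernel :: "complex \<times> complex \<Rightarrow> complex \<times> complex \<Rightarrow> complex" where
  "hartogs_kernel z w = (case z of (z1, z2) \<Rightarrow> case w of (w1, w2) \<Rightarrow>
     1 / (complex_of_real (pi ^ 2) * z2 * cnj w2 * (1 - (z1 * cnj w1) / (z2 * cnj w2)) ^ 2
          * (1 - z2 * cnj w2) ^ 2))"

definition bergman_proj :: "(complex \<times> complex \<Rightarrow> complex) \<Rightarrow> complex \<times> complex \<Rightarrow> complex" where
  "bergman_proj f z = (LINT w : hartogs | lebesgue. hartogs_kernel z w * f w)"

text \<open>hfun k = h_{k+1} of the paper (0-indexed iteration).\<close>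
fun hfun :: "nat \<Rightarrow> complex \<Rightarrow> real" where
  "hfun 0 z = - ln (cmod z) + 1"
| "hfun (Suc k) z = ln (hfun k z + 1) + 1"

text \<open>The paper's h_k, for k \<ge> 1.\<close>
definition h :: "nat \<Rightarrow> complex \<Rightarrow> real" where
  "h k z = hfun (k - 1) z"

definition f_weight :: "real \<Rightarrow> nat \<Rightarrow> complex \<Rightarrow> real" where
  "f_weight \<alpha> j z = cmod z powr (-2) * h j z powr \<alpha> * (\<Prod>k\<in>{1..<j}. inverse (h k z))"

definition mu_weight :: "real \<Rightarrow> nat \<Rightarrow> complex \<times> complex \<Rightarrow> real" where
  "mu_weight \<alpha> j z = (cmod (snd z) ^ 2 * f_weight \<alpha> j (snd z)) powr (-1/3)"

end

theory Submission
  imports Defs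
begin

text \<open>
  The estimate already holds for the integral operator with kernel
  \<open>\<bar>K\<bar>\<close>, by a Schur test. In the coordinates \<open>(z1 / z2, z2)\<close> the kernel is
  a product of two disc kernels \<open>\<bar>1 - z * cnj w\<bar> ^ -2\<close> and powers of \<open>\<bar>z2\<bar>\<close>, \<open>\<bar>w2\<bar>\<close>. With
  \<open>A(z) = (1 - \<bar>z1 / z2\<bar>^2) * (1 - \<bar>z2\<bar>^2)\<close>, the test function
  \<open>P(w) = f_weight (w2) * A(w) powr (-1/2) / \<bar>w2\<bar>\<close> is mapped below a multiple of
  \<open>\<beta>(z) = A(z) powr (-1/2) / \<bar>z2\<bar>\<close>; near \<open>w2 = 0\<close> this only uses that \<open>f_weight\<close> is
  integrable over the disc, which is the role of \<open>\<alpha> < -1\<close>. Dually \<open>\<beta> powr (1/3)\<close> is mapped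
  below a multiple of \<open>mu_weight * P powr (1/3)\<close>.
\<close>

text \<open>Hoelder's inequality in the Schur test is replaced by a pointwise splitting of
  \<open>F\<close>: the part below a multiple of \<open>P\<close> accounts for at most half of the
  level, and the rest goes through Markov's inequality and Tonelli. The obstacle is the singularity
  at \<open>z2 = 0\<close>. The kernel carries 1 / (|z2| |w2|), and integrating out
  \<open>w1\<close> over the disc |w1| < |w2| gives back |w2|^2. A test function
  \<open>f_weight\<close> / |w2| therefore leaves the density \<open>f_weight\<close> on the disc;
  |w|^-2 alone misses integrability by a logarithm, and the iterated logarithms repair this. The
  exponent 4/3 enters through the dual bound. Every test function returns a factor 1 / |w2|, and
  with p - 1 = 1/3 the product of \<open>mu_weight\<close> and \<open>P powr (1/3)\<close> carries
  |w2| to the power -2/3 - 1/3 = -1, while \<open>f_weight\<close> cancels. The power -1/2 of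
  \<open>A\<close> is a choice: the disc integrals converge with the right growth for exponents -s
  with 0 < s < 1, and both 1/2 and its third, 1/6, are such s.\<close>

section \<open>Lebesgue measure on the plane: rotations, dilations, radial integrands\<close>

lemma lborel_complex_eq_distr_vec:
  "distr lborel borel (\<lambda>x::real^2. Complex (x $ 1) (x $ 2)) = lborel"
proof (rule lborel_eqI[symmetric])
  have m: "(\<lambda>x::real^2. Complex (x $ 1) (x $ 2)) \<in> borel_measurable borel"
    by (intro borel_measurable_continuous_onI continuous_intros)
  fix l u :: complex
  assume le: "\<And>b. b \<in> Basis \<Longrightarrow> l \<bullet> b \<le> u \<bullet> b"
  have eq: "(\<lambda>x::real^2. Complex (x $ 1) (x $ 2)) -` box l u
      = box (vector [Re l, Im l]) (vector [Re u, Im u])"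
    by (rule set_eqI) (simp only: vimage_eq mem_box_cart, simp add: forall_2 Basis_complex_def box_def)
  have "Re l \<le> Re u" "Im l \<le> Im u"
    using le[of 1] le[of \<i>] by (auto simp: Basis_complex_def)
  then have "emeasure lborel (box (vector [Re l, Im l] :: real^2) (vector [Re u, Im u]))
      = (Re u - Re l) * (Im u - Im l)"
    by (simp add: emeasure_lborel_box_eq Basis_vec_def inner_axis prod.UNION_disjoint axis_eq_axis
        UNIV_2 prod.insert flip: cart_eq_inner_axis)
  with eq show "emeasure (distr lborel borel (\<lambda>x::real^2. Complex (x $ 1) (x $ 2))) (box l u)
      = ennreal (\<Prod>b\<in>Basis. (u - l) \<bullet> b)"
    using m by (simp add: emeasure_distr Basis_complex_def)
qed simp

text \<open>Orthogonal maps of \<open>real^2\<close> preserve Lebesgue measure, and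
  \<open>\<phi>\<close> carries this over to the plane. Since |c| = 1, the inverse of multiplication
  by \<open>c\<close> is multiplication by \<open>cnj c\<close>, which is \<open>R\<close> in
  coordinates; hence the preimage of a box corresponds to the \<open>R\<close>-image of a box, and
  boxes determine the measure.\<close>

lemma lborel_distr_complex_rotation:
  assumes c: "cmod c = 1"
  shows "distr lborel borel ((*) c) = (lborel :: complex measure)"
proof (rule lborel_eqI[symmetric])
  define \<phi> :: "real^2 \<Rightarrow> complex" where "\<phi> = (\<lambda>x. Complex (x $ 1) (x $ 2))"
  define R :: "real^2 \<Rightarrow> real^2" where "R x = vector [Re (cnj c * \<phi> x), Im (cnj c * \<phi> x)]" for x
  have \<phi>[measurable]: "\<phi> \<in> borel_measurable borel"
    unfolding \<phi>_def by (intro borel_measurable_continuous_onI continuous_intros)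
  have \<phi>R: "\<phi> (R x) = cnj c * \<phi> x" for x
    by (simp add: R_def \<phi>_def complex_eq_iff)
  have cc: "cnj c * c = 1"
    using c by (metis complex_norm_square mult.commute of_real_1 power_one)
  then have cc': "c * (cnj c * x) = x" for x
    by (metis mult.assoc mult.commute mult_1)
  have inj: "\<phi> x = \<phi> y \<longleftrightarrow> x = y" for x y
    by (auto simp: \<phi>_def vec_eq_iff forall_2)
  have surj: "\<exists>x. \<phi> x = z" for z
    by (rule exI[of _ "vector [Re z, Im z]"]) (simp add: \<phi>_def)
  have norm\<phi>: "norm (\<phi> x) = norm x" for x
    by (simp add: \<phi>_def norm_vec_def L2_set_def sum_2 cmod_def)
  have lin: "linear R"
    by (rule linearI) (auto simp: R_def \<phi>_def vec_eq_iff forall_2 algebra_simps)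
  have orth: "orthogonal_transformation R"
    unfolding orthogonal_transformation using lin c norm\<phi> \<phi>R by (metis norm_mult complex_mod_cnj mult_1)
  have m: "((*) c) \<in> borel_measurable borel"
    by (intro borel_measurable_continuous_onI continuous_intros)
  fix l u :: complex
  assume le: "\<And>b. b \<in> Basis \<Longrightarrow> l \<bullet> b \<le> u \<bullet> b"
  define B where "B = \<phi> -` box l u"
  have eq: "B = box (vector [Re l, Im l]) (vector [Re u, Im u])"
    by (rule set_eqI) (simp only: B_def vimage_eq mem_box_cart, simp add: forall_2 Basis_complex_def box_def \<phi>_def)
  have pre: "\<phi> -` (((*) c) -` box l u) = R ` B"
  proof (intro subset_antisym subsetI)
    fix x assume "x \<in> \<phi> -` (((*) c) -` box l u)"
    then have x: "c * \<phi> x \<in> box l u" by simp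
    obtain y where y: "\<phi> y = c * \<phi> x" using surj by blast
    then have "\<phi> (R y) = \<phi> x" using \<phi>R[of y] cc by (simp add: mult.assoc[symmetric])
    then have "x = R y" "y \<in> B" using inj x y by (auto simp: B_def)
    then show "x \<in> R ` B" by blast
  next
    fix x assume "x \<in> R ` B"
    then obtain y where "y \<in> B" "x = R y" by blast
    then show "x \<in> \<phi> -` (((*) c) -` box l u)"
      by (simp add: \<phi>R B_def cc')
  qed
  have B: "B \<in> lmeasurable" unfolding eq by simp
  have X: "((*) c) -` box l u \<in> sets borel"
    by (rule measurable_sets_borel[OF m]) simp
  have RB: "R ` B \<in> sets borel"
    unfolding pre[symmetric]
    by (rule measurable_sets_borel[OF \<phi> X])
  have "emeasure (distr lborel borel ((*) c)) (box l u) = emeasure lborel (((*) c) -` box l u)"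
    using m by (simp add: emeasure_distr)
  also have "\<dots> = emeasure (distr lborel borel \<phi>) (((*) c) -` box l u)"
    unfolding \<phi>_def lborel_complex_eq_distr_vec ..
  also have "\<dots> = emeasure lborel (R ` B)"
    using \<phi> X by (simp add: emeasure_distr pre)
  also have "\<dots> = emeasure lebesgue (R ` B)"
    using RB by simp
  also have "\<dots> = measure lebesgue (R ` B)"
    by (rule emeasure_eq_measure2[OF measurable_orthogonal_image[OF orth B]])
  also have "\<dots> = measure lebesgue B"
    using measure_orthogonal_image[OF orth B] by simp
  also have "\<dots> = emeasure lebesgue B"
    by (rule emeasure_eq_measure2[OF B, symmetric])
  also have "\<dots> = emeasure lborel B"
    unfolding eq by simp
  also have "\<dots> = emeasure (distr lborel borel \<phi>) (box l u)"
    by (subst emeasure_distr) (auto simp: B_def)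
  also have "\<dots> = emeasure lborel (box l u)"
    unfolding \<phi>_def lborel_complex_eq_distr_vec ..
  also have "\<dots> = ennreal (\<Prod>b\<in>Basis. (u - l) \<bullet> b)"
    using le by (simp add: emeasure_lborel_box_eq)
  finally show "emeasure (distr lborel borel ((*) c)) (box l u) = ennreal (\<Prod>b\<in>Basis. (u - l) \<bullet> b)" .
qed simp

lemma nn_integral_complex_rotation:
  fixes g :: "complex \<Rightarrow> ennreal"
  assumes "cmod c = 1" and [measurable]: "g \<in> borel_measurable borel"
  shows "(\<integral>\<^sup>+z. g (c * z) \<partial>lborel) = (\<integral>\<^sup>+z. g z \<partial>lborel)"
proof -
  have m: "((*) c) \<in> borel_measurable borel"
    by (intro borel_measurable_continuous_onI continuous_intros)
  then show ?thesis
    by (subst (2) lborel_distr_complex_rotation[OF assms(1), symmetric]) (simp add: nn_integral_distr)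
qed

lemma nn_integral_complex_scale:
  fixes g :: "complex \<Rightarrow> ennreal"
  assumes r: "r > 0" and [measurable]: "g \<in> borel_measurable borel"
  shows "(\<integral>\<^sup>+z. g z \<partial>lborel) = ennreal (r^2) * (\<integral>\<^sup>+z. g (of_real r * z) \<partial>lborel)"
  using r
  by (subst lborel_affine[of r 0])
     (simp_all add: nn_integral_density nn_integral_distr nn_integral_cmult scaleR_conv_of_real)

text \<open>This stands in for polar coordinates on radial integrands. The disc of squared radius x
  has area pi * x, which is linear in x, so the squared modulus has constant density; half-lines
  suffice to identify the two measures.\<close>

lemma distr_cmod_square:
  "distr lborel borel (\<lambda>z. (cmod z)\<^sup>2) = density lborel (\<lambda>t. ennreal pi * indicator {0..} t)"
    (is "?M = ?N")
proof (rule measure_eqI_generator_eq)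
  let ?E = "range (\<lambda>x::real. {..x})"
  show "Int_stable ?E"
    by (auto simp: Int_stable_def)
  show "?E \<subseteq> Pow UNIV" "sets ?M = sigma_sets UNIV ?E" "sets ?N = sigma_sets UNIV ?E"
    by (simp_all add: borel_eq_atMost)
  have M: "emeasure ?M {..x} = ennreal (pi * max x 0)" for x
  proof (cases "x < 0")
    case True
    then have "(\<lambda>z::complex. (cmod z)\<^sup>2) -` {..x} = {}"
      by (auto simp: not_le dest!: order_trans[OF zero_le_power2])
    with True show ?thesis by (simp add: emeasure_distr)
  next
    case False
    then have "(\<lambda>z::complex. (cmod z)\<^sup>2) -` {..x} = cball 0 (sqrt x)"
      by (auto simp: real_le_rsqrt sqrt_ge_absD)
    with False show ?thesis by (simp add: emeasure_distr emeasure_cball unit_ball_vol_2)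
  qed
  have N: "emeasure ?N {..x} = ennreal (pi * max x 0)" for x
  proof -
    have "emeasure ?N {..x} = (\<integral>\<^sup>+t. ennreal pi * indicator {0..x} t \<partial>lborel)"
      by (subst emeasure_density) (auto intro!: nn_integral_cong simp: indicator_def)
    also have "\<dots> = ennreal pi * emeasure lborel {0..x}"
      by (subst nn_integral_cmult) auto
    also have "\<dots> = ennreal (pi * max x 0)"
      by (cases "x < 0") (auto simp: ennreal_mult)
    finally show ?thesis .
  qed
  show "emeasure ?M X = emeasure ?N X" if "X \<in> ?E" for X
    using that by (auto simp: M N)
  show "range (\<lambda>n::nat. {..real n}) \<subseteq> ?E" "(\<Union>n::nat. {..real n}) = UNIV"
    by (auto simp: real_arch_simple)
  show "emeasure ?M {..real i} \<noteq> \<infinity>" for i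
    by (simp add: M)
qed

lemma nn_integral_complex_radial:
  fixes g :: "real \<Rightarrow> ennreal"
  assumes [measurable]: "g \<in> borel_measurable borel"
  shows "(\<integral>\<^sup>+z. g ((cmod z)\<^sup>2) \<partial>lborel) = ennreal pi * (\<integral>\<^sup>+t. g t * indicator {0..} t \<partial>lborel)"
proof -
  have "(\<integral>\<^sup>+z. g ((cmod z)\<^sup>2) \<partial>lborel) = (\<integral>\<^sup>+t. g t \<partial>distr lborel borel (\<lambda>z. (cmod z)\<^sup>2))"
    by (simp add: nn_integral_distr)
  also have "\<dots> = (\<integral>\<^sup>+t. ennreal pi * indicator {0..} t * g t \<partial>lborel)"
    unfolding distr_cmod_square by (simp add: nn_integral_density)
  also have "\<dots> = ennreal pi * (\<integral>\<^sup>+t. g t * indicator {0..} t \<partial>lborel)"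
    by (subst nn_integral_cmult[symmetric]) (auto intro!: nn_integral_cong simp: mult_ac)
  finally show ?thesis .
qed

section \<open>A Schur test for weak-type bounds\<close>

text \<open>Where \<open>F \<le> r\<close> fails for \<open>r = P / D\<close>, one has \<open>F \<le> r powr (1 - p) * F powr p\<close>.\<close>

lemma weak_type_schur:
  fixes K :: "'a \<Rightarrow> 'a \<Rightarrow> ennreal" and P \<beta> \<mu> F :: "'a \<Rightarrow> real"
  assumes "sigma_finite_measure M"
    and K[measurable]: "case_prod K \<in> borel_measurable (M \<Otimes>\<^sub>M M)"
    and [measurable]: "P \<in> borel_measurable M" "\<beta> \<in> borel_measurable M" "\<mu> \<in> borel_measurable M"
      "F \<in> borel_measurable M" "H \<in> sets M"
    and pos: "\<And>x. x \<in> H \<Longrightarrow> P x > 0" "\<And>x. x \<in> H \<Longrightarrow> \<beta> x > 0" "\<And>x. x \<in> H \<Longrightarrow> \<mu> x \<ge> 0"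
      "\<And>x. F x \<ge> 0"
    and p: "p > 1" and C: "C1 > 0" "C2 \<ge> 0" and lam: "lam > 0"
    and row: "\<And>z. z \<in> H \<Longrightarrow> (\<integral>\<^sup>+w\<in>H. K z w * ennreal (P w) \<partial>M) \<le> ennreal (C1 * \<beta> z)"
    and col: "\<And>w. w \<in> H \<Longrightarrow> (\<integral>\<^sup>+z\<in>H. K z w * ennreal (\<beta> z powr (p - 1)) \<partial>M)
                  \<le> ennreal (C2 * \<mu> w * P w powr (p - 1))"
  shows "emeasure M {z\<in>H. (\<integral>\<^sup>+w\<in>H. K z w * ennreal (F w) \<partial>M) > ennreal lam}
    \<le> ennreal (2 powr p * C1 powr (p - 1) * C2 / lam powr p) * (\<integral>\<^sup>+w\<in>H. ennreal (F w powr p * \<mu> w) \<partial>M)"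
proof -
  interpret sigma_finite_measure M by fact
  interpret pair_sigma_finite M M ..
  \<comment> \<open>The power of \<open>\<beta> z\<close> sits inside the integral over
    \<open>w\<close>, so that exchanging the integrals produces exactly the integral bounded by
    \<open>col\<close>.\<close>
  define I where "I z = (\<integral>\<^sup>+w\<in>H. K z w * ennreal (\<beta> z powr (p - 1)) *
      ennreal (P w powr (1 - p) * F w powr p) \<partial>M)" for z
  have I[measurable]: "I \<in> borel_measurable M"
    unfolding I_def by measurable
  define c where "c = (2 / lam) * (2 * C1 / lam) powr (p - 1)"
  have c: "c > 0" using lam C by (simp add: c_def)
  have key: "1 \<le> ennreal c * I z"
    if z: "z \<in> H" and big: "(\<integral>\<^sup>+w\<in>H. K z w * ennreal (F w) \<partial>M) > ennreal lam" for z
  proof -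
    \<comment> \<open>With this \<open>D\<close> the bound \<open>row\<close> makes the contribution
      of \<open>P w / D\<close> at most \<open>lam / 2\<close>. The remaining term carries
      \<open>D powr (p - 1)\<close>, whose factor \<open>\<beta> z powr (p - 1)\<close> goes into
      \<open>I\<close>; the rest, multiplied by \<open>2 / lam\<close> to normalise the threshold to
      1, is \<open>c\<close>.\<close>
    define D where "D = 2 * C1 * \<beta> z / lam"
    have D: "D > 0" using pos z C lam by (simp add: D_def)
    have pw: "F w \<le> P w / D + D powr (p - 1) * (P w powr (1 - p) * F w powr p)" if "w \<in> H" for w
    proof (cases "F w \<le> P w / D")
      case True
      moreover have "0 \<le> D powr (p - 1) * (P w powr (1 - p) * F w powr p)" by simp
      ultimately show ?thesis by linarith
    next
      case False
      define r where "r = P w / D"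
      have r: "r > 0" "r < F w" using D pos that False by (auto simp: r_def)
      have "F w powr (1 - p) \<le> r powr (1 - p)"
        using r p by (intro powr_mono2') auto
      then have "F w powr (1 - p) * F w powr p \<le> r powr (1 - p) * F w powr p"
        by (intro mult_right_mono) auto
      then have "F w \<le> r powr (1 - p) * F w powr p"
        using r by (simp flip: powr_add)
      also have "r powr (1 - p) = D powr (p - 1) * P w powr (1 - p)"
        using D pos(1)[OF that] by (simp add: r_def powr_divide powr_diff field_simps)
      finally show ?thesis using r(1) by (simp add: r_def)
    qed
    have Kz[measurable]: "K z \<in> borel_measurable M"
    proof (cases "z \<in> space M")
      case True
      then have "(\<lambda>w. case_prod K (z, w)) \<in> borel_measurable M" by measurable
      then show ?thesis by simp
    next
      case False
      with z sets.sets_into_space[OF assms(7)] show ?thesis by auto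
    qed
    have "ennreal lam \<le> (\<integral>\<^sup>+w\<in>H. K z w * ennreal (F w) \<partial>M)" using big by simp
    also have "\<dots> \<le> (\<integral>\<^sup>+w. ennreal (1 / D) * (K z w * ennreal (P w) * indicator H w) +
        ennreal ((2 * C1 / lam) powr (p - 1)) * (K z w * ennreal (\<beta> z powr (p - 1)) *
      ennreal (P w powr (1 - p) * F w powr p) * indicator H w) \<partial>M)"
    proof (intro nn_integral_mono)
      fix w
      show "K z w * ennreal (F w) * indicator H w \<le> ennreal (1 / D) * (K z w * ennreal (P w) * indicator H w) +
        ennreal ((2 * C1 / lam) powr (p - 1)) * (K z w * ennreal (\<beta> z powr (p - 1)) *
      ennreal (P w powr (1 - p) * F w powr p) * indicator H w)"
      proof (cases "w \<in> H")
        case True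
        have "K z w * ennreal (F w) \<le> K z w * ennreal (1 / D * P w + (2 * C1 / lam) powr (p - 1) *
              (\<beta> z powr (p - 1) * (P w powr (1 - p) * F w powr p)))"
          using pw[OF True] pos(2)[OF z] C lam
          by (intro mult_left_mono ennreal_leI) (auto simp: D_def powr_mult powr_divide field_simps)
        also have "\<dots> = ennreal (1 / D) * (K z w * ennreal (P w)) +
        ennreal ((2 * C1 / lam) powr (p - 1)) * (K z w * ennreal (\<beta> z powr (p - 1)) *
      ennreal (P w powr (1 - p) * F w powr p))"
        proof -
          have "ennreal (P w / D) = ennreal (1 / D) * ennreal (P w)"
            using D pos(1)[OF True] by (subst ennreal_mult'[symmetric]) auto
          then show ?thesis
            using D pos(1)[OF True]
            by (subst ennreal_plus) (simp_all add: ennreal_mult' distrib_left mult_ac)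
        qed
        finally show ?thesis using True by simp
      qed simp
    qed
    also have "\<dots> = ennreal (1 / D) * (\<integral>\<^sup>+w\<in>H. K z w * ennreal (P w) \<partial>M) +
        ennreal ((2 * C1 / lam) powr (p - 1)) * I z"
      unfolding I_def by (subst nn_integral_add) (simp_all add: nn_integral_cmult)
    also have "\<dots> \<le> ennreal (1 / D) * ennreal (C1 * \<beta> z) + ennreal ((2 * C1 / lam) powr (p - 1)) * I z"
      by (intro add_mono mult_left_mono row z) auto
    also have "ennreal (1 / D) * ennreal (C1 * \<beta> z) = ennreal (lam / 2)"
      using D C pos(2)[OF z] lam by (subst ennreal_mult'[symmetric]) (auto simp: D_def)
    finally have *: "ennreal lam \<le> ennreal (lam / 2) + ennreal ((2 * C1 / lam) powr (p - 1)) * I z" .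
    have "ennreal (lam / 2) \<le> ennreal ((2 * C1 / lam) powr (p - 1)) * I z"
    proof -
      have "ennreal (lam / 2) + ennreal (lam / 2) = ennreal lam"
        using lam by (subst ennreal_plus[symmetric]) auto
      with * show ?thesis by (metis ennreal_add_left_cancel_le ennreal_neq_top infinity_ennreal_def)
    qed
    then have "ennreal (2 / lam) * ennreal (lam / 2) \<le> ennreal (2 / lam) * (ennreal ((2 * C1 / lam) powr (p - 1)) * I z)"
      by (intro mult_left_mono) auto
    moreover have "ennreal c = ennreal (2 / lam) * ennreal ((2 * C1 / lam) powr (p - 1))"
      unfolding c_def using lam by (intro ennreal_mult') auto
    moreover have "ennreal (2 / lam) * ennreal (lam / 2) = 1"
      using lam by (subst ennreal_mult'[symmetric]) auto
    ultimately show ?thesis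
      by (simp add: mult.assoc)
  qed
  have "emeasure M {z\<in>H. (\<integral>\<^sup>+w\<in>H. K z w * ennreal (F w) \<partial>M) > ennreal lam}
      \<le> emeasure M {z\<in>H. 1 \<le> ennreal c * I z}"
    using key by (intro emeasure_mono) auto
  also have "\<dots> \<le> ennreal c * (\<integral>\<^sup>+z\<in>H. I z \<partial>M)"
    by (intro nn_integral_Markov_inequality) auto
  also have "(\<integral>\<^sup>+z\<in>H. I z \<partial>M) = (\<integral>\<^sup>+z. (\<integral>\<^sup>+w. K z w * ennreal (\<beta> z powr (p - 1)) *
      ennreal (P w powr (1 - p) * F w powr p) * indicator H w * indicator H z \<partial>M) \<partial>M)"
    unfolding I_def by (intro nn_integral_cong nn_integral_multc[symmetric]) auto
  also have "\<dots> = (\<integral>\<^sup>+w. (\<integral>\<^sup>+z. K z w * ennreal (\<beta> z powr (p - 1)) *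
      ennreal (P w powr (1 - p) * F w powr p) * indicator H w * indicator H z \<partial>M) \<partial>M)"
    by (intro Fubini'[symmetric]) auto
  also have "\<dots> = (\<integral>\<^sup>+w\<in>H. ennreal (P w powr (1 - p) * F w powr p) *
       (\<integral>\<^sup>+z\<in>H. K z w * ennreal (\<beta> z powr (p - 1)) \<partial>M) \<partial>M)"
  proof (intro nn_integral_cong)
    fix w assume [measurable]: "w \<in> space M"
    show "(\<integral>\<^sup>+z. K z w * ennreal (\<beta> z powr (p - 1)) *
      ennreal (P w powr (1 - p) * F w powr p) * indicator H w * indicator H z \<partial>M) =
      ennreal (P w powr (1 - p) * F w powr p) *
       (\<integral>\<^sup>+z\<in>H. K z w * ennreal (\<beta> z powr (p - 1)) \<partial>M) * indicator H w"
      by (subst nn_integral_cmult[symmetric], simp, subst nn_integral_multc[symmetric], simp)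
         (auto intro!: nn_integral_cong simp: mult_ac)
  qed
  also have "\<dots> \<le> (\<integral>\<^sup>+w\<in>H. ennreal C2 * ennreal (F w powr p * \<mu> w) \<partial>M)"
  proof (intro nn_integral_mono)
    fix w
    show "ennreal (P w powr (1 - p) * F w powr p) *
       (\<integral>\<^sup>+z\<in>H. K z w * ennreal (\<beta> z powr (p - 1)) \<partial>M) * indicator H w
       \<le> ennreal C2 * ennreal (F w powr p * \<mu> w) * indicator H w"
    proof (cases "w \<in> H")
      case True
      have "ennreal (P w powr (1 - p) * F w powr p) *
          (\<integral>\<^sup>+z\<in>H. K z w * ennreal (\<beta> z powr (p - 1)) \<partial>M)
         \<le> ennreal (P w powr (1 - p) * F w powr p) * ennreal (C2 * \<mu> w * P w powr (p - 1))"
        by (intro mult_left_mono col True) auto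
      also have "\<dots> = ennreal C2 * ennreal (F w powr p * \<mu> w)"
      proof -
        have "P w powr (1 - p) * P w powr (p - 1) = 1"
          using pos(1)[OF True] by (simp flip: powr_add)
        then have "P w powr (1 - p) * F w powr p * (C2 * \<mu> w * P w powr (p - 1)) = C2 * (F w powr p * \<mu> w)"
          by (simp add: algebra_simps)
        then show ?thesis using C pos(3)[OF True] by (simp flip: ennreal_mult')
      qed
      finally show ?thesis using True by simp
    qed simp
  qed
  also have "\<dots> = ennreal C2 * (\<integral>\<^sup>+w\<in>H. ennreal (F w powr p * \<mu> w) \<partial>M)"
    by (subst nn_integral_cmult[symmetric]) (auto simp: mult.assoc)
  also have "ennreal c * \<dots> = ennreal (c * C2) * (\<integral>\<^sup>+w\<in>H. ennreal (F w powr p * \<mu> w) \<partial>M)"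
    using c by (simp add: ennreal_mult' mult.assoc)
  also have "c * C2 = 2 powr p * C1 powr (p - 1) * C2 / lam powr p"
    using lam C by (simp add: c_def powr_mult powr_divide powr_diff field_simps)
  finally show ?thesis by (simp add: mult_left_mono)
qed

section \<open>The Forelli-Rudin estimate on the unit disc\<close>

text \<open>Split at \<open>e\<close>. Below, the denominator is \<open>e\<close> and s < 1 makes
  the power integrable at 0, which gives the term 1 / (1 - s). Above, the integrand is the power -s
  - 1, whose integral is dominated by its lower endpoint because s > 0, which gives 1 / s.\<close>

lemma nn_integral_powr_div_max_le:
  fixes s e :: real
  assumes s: "0 < s" "s < 1" and e: "0 < e" "e \<le> 1"
  shows "(\<integral>\<^sup>+t\<in>{0..1}. ennreal (t powr (-s) / max t e) \<partial>lborel)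
    \<le> ennreal ((1 / (1 - s) + 1 / s) * e powr (-s))"
proof -
  have "((\<lambda>t. t powr (-s)) has_integral (e powr (-s + 1) / (-s + 1))) {0..e}"
    using s e by (intro has_integral_powr_from_0) auto
  from nn_integral_has_integral_lebesgue'[OF _ this]
  have 1: "(\<integral>\<^sup>+t. ennreal (t powr (-s)) * indicator {0..e} t \<partial>lborel) = ennreal (e powr (1 - s) / (1 - s))"
    by simp
  have 2: "(\<integral>\<^sup>+t. ennreal (t powr (-s - 1)) * indicator {e..1} t \<partial>lborel)
      = ennreal (- (1 powr (-s)) / s - - (e powr (-s)) / s)"
    by (rule nn_integral_FTC_Icc) (use s e in \<open>auto intro!: derivative_eq_intros\<close>)
  have "(\<integral>\<^sup>+t\<in>{0..1}. ennreal (t powr (-s) / max t e) \<partial>lborel) \<le>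
      (\<integral>\<^sup>+t. ennreal (1 / e) * (ennreal (t powr (-s)) * indicator {0..e} t)
        + ennreal (t powr (-s - 1)) * indicator {e..1} t \<partial>lborel)"
  proof (intro nn_integral_mono)
    fix t :: real
    consider "t < 0 \<or> t > 1" | "0 \<le> t" "t \<le> e" "t \<le> 1" | "e < t" "t \<le> 1" by linarith
    then show "ennreal (t powr (-s) / max t e) * indicator {0..1} t
      \<le> ennreal (1 / e) * (ennreal (t powr (-s)) * indicator {0..e} t)
        + ennreal (t powr (-s - 1)) * indicator {e..1} t"
    proof cases
      case 2
      have "ennreal (t powr (-s) / max t e) \<le> ennreal (1 / e) * ennreal (t powr (-s))"
        using 2 e by (subst ennreal_mult'[symmetric]) (auto simp: max_def)
      with 2 show ?thesis by (auto intro: add_increasing2)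
    next
      case 3
      have "t powr (-s) / max t e = t powr (-s - 1)"
        using 3 e by (simp add: powr_diff)
      with 3 e show ?thesis by simp
    qed auto
  qed
  also have "\<dots> = ennreal (1 / e) * ennreal (e powr (1 - s) / (1 - s)) +
      ennreal (- (1 powr (-s)) / s - - (e powr (-s)) / s)"
    by (subst nn_integral_add, measurable, subst nn_integral_cmult, measurable) (simp only: 1 2)
  also have "ennreal (1 / e) * ennreal (e powr (1 - s) / (1 - s)) = ennreal (e powr (-s) / (1 - s))"
    using s e by (subst ennreal_mult'[symmetric]) (auto simp: powr_diff powr_minus field_simps)
  also have "ennreal (- (1 powr (-s)) / s - - (e powr (-s)) / s) \<le> ennreal (e powr (-s) / s)"
    using s by (intro ennreal_leI) (auto simp: field_simps)
  also have "ennreal (e powr (-s) / (1 - s)) + ennreal (e powr (-s) / s)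
      = ennreal ((1 / (1 - s) + 1 / s) * e powr (-s))"
    using s by (subst ennreal_plus[symmetric]) (auto simp: field_simps)
  finally show ?thesis by (simp add: add_left_mono)
qed

text \<open>This is the real part of (1 + a) / (1 - a), hence harmonic on the unit disc with value 1
  at 0. That is why its averages over rotations stay bounded although the kernel itself does
  not.\<close>

definition poisson_kernel :: "complex \<Rightarrow> real" where
  "poisson_kernel a = (1 - (cmod a)\<^sup>2) / (cmod (1 - a))\<^sup>2"

lemma measurable_poisson_kernel [measurable]: "poisson_kernel \<in> borel_measurable borel"
  unfolding poisson_kernel_def by measurable

lemma poisson_kernel_nonneg: "cmod a \<le> 1 \<Longrightarrow> poisson_kernel a \<ge> 0"
  by (simp add: poisson_kernel_def power_le_one)

text \<open>In terms of real parts this is (1 + a) / (1 - a) + (1 - a) / (1 + a) = 2 (1 + a^2) / (1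
  - a^2). The computation below rests on the parallelogram law for 1 - a and 1 + a.\<close>

lemma poisson_kernel_add_neg:
  assumes "cmod a < 1"
  shows "poisson_kernel a + poisson_kernel (-a) = 2 * poisson_kernel (a\<^sup>2)"
proof -
  have "a \<noteq> 1" "a \<noteq> -1" using assms by auto
  then have nz: "cmod (1 - a) \<noteq> 0" "cmod (1 + a) \<noteq> 0" by (auto simp: add_eq_0_iff)
  have *: "cmod (1 - a\<^sup>2) = cmod (1 - a) * cmod (1 + a)"
    by (simp add: power2_eq_square algebra_simps flip: norm_mult)
  have "(cmod (1 - a))\<^sup>2 + (cmod (1 + a))\<^sup>2 = 2 * (1 + (cmod a)\<^sup>2)"
    unfolding cmod_power2 by (simp add: power2_eq_square algebra_simps)
  then have "(1 - (cmod a)\<^sup>2) * ((cmod (1 - a))\<^sup>2 + (cmod (1 + a))\<^sup>2)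
      = 2 * (1 - ((cmod a)\<^sup>2)\<^sup>2)"
    by (simp add: power2_eq_square algebra_simps)
  then show ?thesis
    using nz unfolding poisson_kernel_def * norm_power
    by (simp add: field_simps power_mult_distrib)
qed

text \<open>On |a| = r the kernel is at most (1 + r) / (1 - r), which equals 3 at r = 1/2.\<close>

lemma poisson_kernel_le:
  assumes "cmod a \<le> 1 / 2"
  shows "poisson_kernel a \<le> 3"
proof -
  define r where "r = cmod a"
  have r: "0 \<le> r" "r \<le> 1 / 2" using assms by (auto simp: r_def)
  have "1 - r \<le> cmod (1 - a)" unfolding r_def by (metis norm_one norm_triangle_ineq2)
  then have "(1 - r)\<^sup>2 \<le> (cmod (1 - a))\<^sup>2" using r by (intro power_mono) auto
  moreover have "1 - r\<^sup>2 \<le> 3 * (1 - r)\<^sup>2"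
  proof -
    have "0 \<le> (1 - r) * (2 - 4 * r)" using r by (intro mult_nonneg_nonneg) auto
    then show ?thesis by (simp add: power2_eq_square algebra_simps)
  qed
  ultimately have "1 - r\<^sup>2 \<le> 3 * (cmod (1 - a))\<^sup>2" by linarith
  moreover have "cmod (1 - a) \<noteq> 0" using assms by auto
  ultimately show ?thesis unfolding poisson_kernel_def r_def by (simp add: field_simps)
qed

lemma pred_ball [measurable]: "Measurable.pred borel (\<lambda>v::'a::metric_space. v \<in> ball c r)"
  by (rule pred_sets2[OF borel_open]) auto

lemma norm_mult_cnj_less_1:
  assumes "cmod u < 1" "cmod v < 1"
  shows "cmod (u * cnj v) < 1"
  using mult_strict_mono'[OF assms norm_ge_zero norm_ge_zero] by (simp add: norm_mult)

text \<open>Averaging over the rotation by \<open>cis (pi / m)\<close> turns \<open>b = (u * cnj v) ^ m\<close> into \<open>- b\<close>.\<close>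

lemma nn_integral_radial_poisson_double:
  fixes \<rho> :: "real \<Rightarrow> ennreal"
  assumes [measurable]: "\<rho> \<in> borel_measurable borel" and u: "cmod u < 1" and m: "m > 0"
  shows "(\<integral>\<^sup>+v\<in>ball 0 1. \<rho> ((cmod v)\<^sup>2) * ennreal (poisson_kernel ((u * cnj v) ^ m)) \<partial>lborel)
    = (\<integral>\<^sup>+v\<in>ball 0 1. \<rho> ((cmod v)\<^sup>2) * ennreal (poisson_kernel ((u * cnj v) ^ (2 * m))) \<partial>lborel)"
    (is "?J = ?J2")
proof -
  define c where "c = cis (pi / m)"
  have c: "cmod c = 1" by (simp add: c_def)
  have "cis (- pi) = -1" by (simp add: complex_eq_iff)
  then have cm: "cnj c ^ m = -1"
    using m by (simp add: c_def Complex.DeMoivre cis_cnj flip: complex_cnj_power)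
  have [measurable]: "cnj \<in> borel_measurable borel"
    by (intro borel_measurable_continuous_onI continuous_intros)
  have "?J = (\<integral>\<^sup>+v. \<rho> ((cmod (c * v))\<^sup>2) * ennreal (poisson_kernel ((u * cnj (c * v)) ^ m)) *
      indicator (ball 0 1) (c * v) \<partial>lborel)"
    by (rule nn_integral_complex_rotation[OF c, symmetric]) measurable
  also have "\<dots> = (\<integral>\<^sup>+v\<in>ball 0 1. \<rho> ((cmod v)\<^sup>2) * ennreal (poisson_kernel (- ((u * cnj v) ^ m))) \<partial>lborel)"
    using c cm by (intro nn_integral_cong)
      (auto simp: norm_mult power_mult_distrib indicator_def)
  finally have J: "?J = (\<integral>\<^sup>+v\<in>ball 0 1. \<rho> ((cmod v)\<^sup>2) * ennreal (poisson_kernel (- ((u * cnj v) ^ m))) \<partial>lborel)" .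
  have "2 * ?J = ?J + (\<integral>\<^sup>+v\<in>ball 0 1. \<rho> ((cmod v)\<^sup>2) * ennreal (poisson_kernel (- ((u * cnj v) ^ m))) \<partial>lborel)"
    unfolding J[symmetric] by (simp add: mult_2)
  also have "\<dots> = (\<integral>\<^sup>+v. 2 * (\<rho> ((cmod v)\<^sup>2) * ennreal (poisson_kernel ((u * cnj v) ^ (2 * m))) *
      indicator (ball 0 1) v) \<partial>lborel)"
  proof (subst nn_integral_add[symmetric], measurable, intro nn_integral_cong)
    fix v
    show "\<rho> ((cmod v)\<^sup>2) * ennreal (poisson_kernel ((u * cnj v) ^ m)) * indicator (ball 0 1) v +
      \<rho> ((cmod v)\<^sup>2) * ennreal (poisson_kernel (- ((u * cnj v) ^ m))) * indicator (ball 0 1) v =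
      2 * (\<rho> ((cmod v)\<^sup>2) * ennreal (poisson_kernel ((u * cnj v) ^ (2 * m))) * indicator (ball 0 1) v)"
    proof (cases "v \<in> ball 0 1")
      case True
      then have "cmod v < 1" by simp
      with u have "cmod (u * cnj v) < 1"
        by (rule norm_mult_cnj_less_1)
      then have b: "cmod ((u * cnj v) ^ m) < 1"
        using m power_strict_mono[of _ 1 m] unfolding norm_power by fastforce
      have "ennreal (poisson_kernel ((u * cnj v) ^ m)) + ennreal (poisson_kernel (- ((u * cnj v) ^ m)))
          = ennreal (2 * poisson_kernel ((u * cnj v) ^ (2 * m)))"
        using b by (subst ennreal_plus[symmetric])
          (auto simp: poisson_kernel_nonneg poisson_kernel_add_neg power_mult mult.commute[of 2])
      also have "\<dots> = 2 * ennreal (poisson_kernel ((u * cnj v) ^ (2 * m)))"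
        by (simp add: ennreal_mult')
      finally have eq: "ennreal (poisson_kernel ((u * cnj v) ^ m)) + ennreal (poisson_kernel (- ((u * cnj v) ^ m)))
          = 2 * ennreal (poisson_kernel ((u * cnj v) ^ (2 * m)))" .
      show ?thesis
        using True by (simp only: indicator_simps mult_1_right flip: distrib_left)
          (simp only: eq mult.left_commute)
    qed simp
  qed
  also have "\<dots> = 2 * ?J2"
    by (intro nn_integral_cmult) measurable
  finally show ?thesis
    by (simp add: ennreal_mult_cancel_left)
qed

text \<open>Repeated doubling leaves the integral unchanged, while the argument (u * cnj v) ^ 2 ^ n
  shrinks uniformly in \<open>v\<close> because |u| < 1. Once its modulus is below 1/2 the kernel is
  at most 3, a bound that no longer depends on \<open>u\<close>. The mean value property would give
  the constant 1; any constant independent of \<open>u\<close> serves.\<close>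

lemma nn_integral_radial_poisson_le:
  fixes \<rho> :: "real \<Rightarrow> ennreal"
  assumes [measurable]: "\<rho> \<in> borel_measurable borel" and u: "cmod u < 1"
  shows "(\<integral>\<^sup>+v\<in>ball 0 1. \<rho> ((cmod v)\<^sup>2) * ennreal (poisson_kernel (u * cnj v)) \<partial>lborel)
    \<le> 3 * (\<integral>\<^sup>+v\<in>ball 0 1. \<rho> ((cmod v)\<^sup>2) \<partial>lborel)"
proof -
  define J where
    "J m = (\<integral>\<^sup>+v\<in>ball 0 1. \<rho> ((cmod v)\<^sup>2) * ennreal (poisson_kernel ((u * cnj v) ^ m)) \<partial>lborel)" for m
  have "J (2 * m) = J m" if "m > 0" for m
    unfolding J_def by (rule nn_integral_radial_poisson_double[OF assms(1) u that, symmetric])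
  then have J: "J (2 ^ n) = J 1" for n
    by (induction n) simp_all
  obtain n where n: "cmod u ^ n < 1 / 2"
    using real_arch_pow_inv[of "1/2" "cmod u"] u by auto
  have "J 1 = J (2 ^ n)" by (simp add: J)
  also have "\<dots> \<le> (\<integral>\<^sup>+v. 3 * (\<rho> ((cmod v)\<^sup>2) * indicator (ball 0 1) v) \<partial>lborel)"
    unfolding J_def
  proof (intro nn_integral_mono)
    fix v
    show "\<rho> ((cmod v)\<^sup>2) * ennreal (poisson_kernel ((u * cnj v) ^ 2 ^ n)) * indicator (ball 0 1) v
      \<le> 3 * (\<rho> ((cmod v)\<^sup>2) * indicator (ball 0 1) v)"
    proof (cases "v \<in> ball 0 1")
      case True
      then have "cmod (u * cnj v) \<le> cmod u"
        by (simp add: norm_mult mult_left_le)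
      then have "cmod ((u * cnj v) ^ 2 ^ n) \<le> cmod u ^ 2 ^ n"
        unfolding norm_power by (intro power_mono) auto
      also have "\<dots> \<le> cmod u ^ n"
        using u by (intro power_decreasing) (auto intro: less_imp_le)
      finally have "poisson_kernel ((u * cnj v) ^ 2 ^ n) \<le> 3"
        using n by (intro poisson_kernel_le) auto
      then have "ennreal (poisson_kernel ((u * cnj v) ^ 2 ^ n)) \<le> 3"
        using ennreal_leI by fastforce
      then have "\<rho> ((cmod v)\<^sup>2) * ennreal (poisson_kernel ((u * cnj v) ^ 2 ^ n)) \<le> \<rho> ((cmod v)\<^sup>2) * 3"
        by (intro mult_left_mono) auto
      then show ?thesis using True by (simp add: mult.commute)
    qed simp
  qed
  also have "\<dots> = 3 * (\<integral>\<^sup>+v\<in>ball 0 1. \<rho> ((cmod v)\<^sup>2) \<partial>lborel)"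
    by (intro nn_integral_cmult) measurable
  finally show ?thesis by (simp add: J_def)
qed

text \<open>For b = u * cnj v, the factor 1 / |1 - b|^2 is the Poisson kernel of b divided by 1 -
  |u|^2 |v|^2. All other factors are radial in \<open>v\<close>, so the Poisson kernel can be traded
  for the constant 3. With t = 1 - |v|^2 and e = 1 - |u|^2, the denominator 1 - |u|^2 (1 - t) is at
  least both t and e, and a one-dimensional integral remains.\<close>

lemma forelli_rudin_disc:
  fixes s :: real
  assumes s: "0 < s" "s < 1" and u: "cmod u < 1"
  shows "(\<integral>\<^sup>+v\<in>ball 0 1. ennreal ((1 - (cmod v)\<^sup>2) powr (-s) / (cmod (1 - u * cnj v))\<^sup>2) \<partial>lborel)
    \<le> ennreal (3 * pi * (1 / (1 - s) + 1 / s) * (1 - (cmod u)\<^sup>2) powr (-s))"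
proof -
  define e where "e = 1 - (cmod u)\<^sup>2"
  have e: "0 < e" "e \<le> 1"
    using u by (auto simp: e_def abs_square_less_1)
  define \<rho> where "\<rho> t = ennreal ((1 - t) powr (-s) / (1 - (cmod u)\<^sup>2 * t))" for t :: real
  have [measurable]: "\<rho> \<in> borel_measurable borel"
    unfolding \<rho>_def by measurable
  have "(\<integral>\<^sup>+v\<in>ball 0 1. ennreal ((1 - (cmod v)\<^sup>2) powr (-s) / (cmod (1 - u * cnj v))\<^sup>2) \<partial>lborel)
      = (\<integral>\<^sup>+v\<in>ball 0 1. \<rho> ((cmod v)\<^sup>2) * ennreal (poisson_kernel (u * cnj v)) \<partial>lborel)"
  proof (intro nn_integral_cong)
    fix v :: complex
    show "ennreal ((1 - (cmod v)\<^sup>2) powr (-s) / (cmod (1 - u * cnj v))\<^sup>2) * indicator (ball 0 1) v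
      = \<rho> ((cmod v)\<^sup>2) * ennreal (poisson_kernel (u * cnj v)) * indicator (ball 0 1) v"
    proof (cases "v \<in> ball 0 1")
      case True
      then have "cmod v < 1" by simp
      with u have b: "cmod (u * cnj v) < 1"
        by (rule norm_mult_cnj_less_1)
      then have "(cmod (u * cnj v))\<^sup>2 < 1"
        by (simp add: abs_square_less_1)
      then have "(cmod u)\<^sup>2 * (cmod v)\<^sup>2 < 1" by (simp add: norm_mult power_mult_distrib)
      then show ?thesis
        using True b
        by (simp add: \<rho>_def poisson_kernel_nonneg flip: ennreal_mult'')
           (simp add: poisson_kernel_def norm_mult power_mult_distrib)
    qed simp
  qed
  also have "\<dots> \<le> 3 * (\<integral>\<^sup>+v\<in>ball 0 1. \<rho> ((cmod v)\<^sup>2) \<partial>lborel)"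
    by (intro nn_integral_radial_poisson_le u) measurable
  also have "(\<integral>\<^sup>+v\<in>ball 0 1. \<rho> ((cmod v)\<^sup>2) \<partial>lborel)
      = (\<integral>\<^sup>+v. \<rho> ((cmod v)\<^sup>2) * indicator {..<1} ((cmod v)\<^sup>2) \<partial>lborel)"
    by (intro nn_integral_cong) (auto simp: indicator_def abs_square_less_1)
  also have "\<dots> = ennreal pi * (\<integral>\<^sup>+t. \<rho> t * indicator {..<1} t * indicator {0..} t \<partial>lborel)"
    by (rule nn_integral_complex_radial) measurable
  also have "(\<integral>\<^sup>+t. \<rho> t * indicator {..<1} t * indicator {0..} t \<partial>lborel)
      = (\<integral>\<^sup>+t. \<rho> (1 - t) * indicator {..<1} (1 - t) * indicator {0..} (1 - t) \<partial>lborel)"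
    by (subst nn_integral_real_affine[where c="-1" and t=1]) (auto simp: \<rho>_def)
  also have "\<dots> \<le> (\<integral>\<^sup>+t\<in>{0..1}. ennreal (t powr (-s) / max t e) \<partial>lborel)"
  proof (intro nn_integral_mono)
    fix t :: real
    show "\<rho> (1 - t) * indicator {..<1} (1 - t) * indicator {0..} (1 - t)
        \<le> ennreal (t powr (-s) / max t e) * indicator {0..1} t"
    proof (cases "0 < t \<and> t \<le> 1")
      case True
      have "(cmod u)\<^sup>2 * (1 - t) \<le> 1 - t" "(cmod u)\<^sup>2 * (1 - t) \<le> (cmod u)\<^sup>2"
        using True e by (auto simp: e_def mult_left_le mult_left_le_one_le)
      then have "max t e \<le> 1 - (cmod u)\<^sup>2 * (1 - t)"
        by (auto simp: e_def)
      then have "t powr (-s) / (1 - (cmod u)\<^sup>2 * (1 - t)) \<le> t powr (-s) / max t e"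
        using e by (intro divide_left_mono) auto
      then show ?thesis using True by (auto simp: \<rho>_def intro: ennreal_leI)
    qed (auto simp: indicator_def)
  qed
  also have "\<dots> \<le> ennreal ((1 / (1 - s) + 1 / s) * e powr (-s))"
    by (rule nn_integral_powr_div_max_le[OF s e])
  also have "3 * (ennreal pi * ennreal ((1 / (1 - s) + 1 / s) * e powr (-s)))
      = ennreal (3 * pi * (1 / (1 - s) + 1 / s) * e powr (-s))"
  proof -
    have "ennreal (3 * (pi * x)) = 3 * (ennreal pi * ennreal x)" for x
      by (simp add: ennreal_mult')
    then show ?thesis by (simp only: mult.assoc)
  qed
  finally show ?thesis by (simp add: e_def mult_left_mono)
qed

section \<open>Iterated logarithms and the integrability of \<open>f_weight\<close>\<close>

lemma hfun_ge_1: "\<lbrakk>z \<noteq> 0; cmod z \<le> 1\<rbrakk> \<Longrightarrow> hfun k z \<ge> 1"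
  by (induction k) auto

lemma measurable_hfun [measurable]: "hfun k \<in> borel_measurable borel"
proof (induction k)
  case 0
  have "hfun 0 = (\<lambda>z. - ln (cmod z) + 1)" by auto
  then show ?case by simp
next
  case (Suc k)
  note [measurable] = Suc
  have "hfun (Suc k) = (\<lambda>z. ln (hfun k z + 1) + 1)" by auto
  then show ?case by simp
qed

lemma hfun_cmod: "hfun k (complex_of_real (cmod z)) = hfun k z"
  by (induction k) auto

lemma f_weight_Suc:
  "f_weight \<alpha> (Suc n) z = cmod z powr (-2) * hfun n z powr \<alpha> * (\<Prod>i<n. inverse (hfun i z))"
proof -
  have "(\<Prod>k\<in>{1..<Suc n}. inverse (h k z)) = (\<Prod>i\<in>{0..<n}. inverse (h (Suc i) z))"
    using prod.shift_bounds_Suc_ivl[of "\<lambda>k. inverse (h k z)" 0 n] by simp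
  then show ?thesis
    by (simp add: f_weight_def h_def atLeast0LessThan)
qed

lemma measurable_f_weight [measurable]: "f_weight \<alpha> j \<in> borel_measurable borel"
proof -
  have "h k \<in> borel_measurable borel" for k
    using measurable_hfun[of "k - 1"] by (simp add: h_def[abs_def])
  note [measurable] = this
  have "f_weight \<alpha> j = (\<lambda>z. cmod z powr (-2) * h j z powr \<alpha> * (\<Prod>k\<in>{1..<j}. inverse (h k z)))"
    by (auto simp: f_weight_def)
  then show ?thesis by simp
qed

lemma f_weight_pos:
  assumes "z \<noteq> 0" "cmod z \<le> 1"
  shows "f_weight \<alpha> j z > 0"
proof -
  have "h k z > 0" for k
    using hfun_ge_1[OF assms, of "k - 1"] by (simp add: h_def)
  moreover from this[of j] have "h j z powr \<alpha> > 0"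
    by simp
  ultimately show ?thesis
    using assms by (auto simp: f_weight_def intro!: mult_pos_pos prod_pos)
qed

text \<open>All the iterated logarithms are at least 1, so with a nonpositive exponent they can only
  lower the weight. The bound serves away from the origin, where |z|^-2 is harmless.\<close>

lemma f_weight_le:
  assumes "z \<noteq> 0" "cmod z \<le> 1" "\<alpha> \<le> 0"
  shows "f_weight \<alpha> j z \<le> cmod z powr (-2)"
proof -
  have h: "h k z \<ge> 1" for k
    using hfun_ge_1[OF assms(1,2), of "k - 1"] by (simp add: h_def)
  have "h j z powr \<alpha> \<le> 1"
    using powr_mono[OF assms(3) h] by (simp add: h[THEN less_le_trans[OF zero_less_one], THEN less_imp_neq, symmetric])
  moreover have "(\<Prod>k\<in>{1..<j}. inverse (h k z)) \<le> 1"
    using h by (intro prod_le_1) (auto simp: inverse_le_1_iff intro: order_trans[OF zero_le_one])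
  ultimately have "h j z powr \<alpha> * (\<Prod>k\<in>{1..<j}. inverse (h k z)) \<le> 1"
    using h by (intro mult_le_one prod_nonneg) (auto intro: order_trans[OF zero_le_one])
  then show ?thesis
    unfolding f_weight_def mult.assoc by (intro mult_left_le) auto
qed

text \<open>The variable is t = |z|^2, as in the radial integral formula. The innermost function is
  1 - ln t / 2, and each further logarithm adds one factor 1 / (hfun i + 1) by the chain
  rule.\<close>

lemma hfun_sqrt_has_derivative:
  assumes t: "0 < t" "t \<le> 1"
  shows "((\<lambda>t. hfun n (complex_of_real (sqrt t))) has_real_derivative
    (- (1 / (2 * t)) * (\<Prod>i<n. 1 / (hfun i (complex_of_real (sqrt t)) + 1)))) (at t)"
proof (induction n)
  case 0
  have "((\<lambda>t. - (ln t / 2) + 1) has_real_derivative - (1 / (2 * t))) (at t)"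
    using t by (auto intro!: derivative_eq_intros simp: field_simps)
  then have "((\<lambda>t. hfun 0 (complex_of_real (sqrt t))) has_real_derivative - (1 / (2 * t))) (at t)"
    using t by (rule_tac has_field_derivative_transform_within_open[where S = "{0<..}"]) (auto simp: ln_sqrt)
  then show ?case by simp
next
  case (Suc n)
  have "hfun n (complex_of_real (sqrt t)) \<ge> 1"
    using t by (intro hfun_ge_1) auto
  then show ?case
    by (auto intro!: derivative_eq_intros Suc.IH simp: field_simps)
qed

text \<open>In t = |z|^2 the weight is comparable to the derivative of a multiple of
  \<open>H n t powr (\<alpha> + 1)\<close>. The multiple must be negative before dividing by nothing
  else: \<open>\<alpha> + 1 < 0\<close> makes this power decrease towards t = 0, so a positive
  multiple \<open>G\<close> is an increasing and nonnegative primitive, and the integral is at most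
  \<open>G 1\<close> up to the factor pi.\<close>

lemma nn_integral_f_weight_finite:
  assumes \<alpha>: "\<alpha> < -1"
  shows "(\<integral>\<^sup>+z\<in>ball 0 1. ennreal (f_weight \<alpha> (Suc n) z) \<partial>lborel) < \<infinity>"
proof -
  define H where "H k t = hfun k (complex_of_real (sqrt t))" for k t
  have [measurable]: "H k \<in> borel_measurable borel" for k
  proof -
    have "(\<lambda>t. complex_of_real (sqrt t)) \<in> borel_measurable borel"
      by (intro borel_measurable_continuous_onI continuous_intros)
    then show ?thesis unfolding H_def[abs_def] by measurable
  qed
  have H1: "H k t \<ge> 1" if "0 < t" "t \<le> 1" for k t
    unfolding H_def using that by (intro hfun_ge_1) auto
  define \<phi> where "\<phi> t = t powr (-1) * H n t powr \<alpha> * (\<Prod>i<n. inverse (H i t))" for t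
  have [measurable]: "\<phi> \<in> borel_measurable borel" unfolding \<phi>_def[abs_def] by measurable
  \<comment> \<open>The factor 2 cancels the one in 1 / (2 t), and \<alpha> + 1 cancels the exponent
    brought down by differentiation. The power 2 ^ n pays for replacing each 1 / H by 2 / (H + 1),
    which is legitimate since H is at least 1.\<close>
  define c where "c = - (2 * 2 ^ n / (\<alpha> + 1))"
  have c: "c > 0" using \<alpha> by (simp add: c_def divide_pos_neg)
  define G where "G t = c * H n t powr (\<alpha> + 1)" for t
  define G' where "G' t = 2 ^ n * (1 / t) * H n t powr \<alpha> * (\<Prod>i<n. 1 / (H i t + 1))" for t
  have [measurable]: "G' \<in> borel_measurable borel" unfolding G'_def[abs_def] by measurable
  have G: "(G has_real_derivative G' t) (at t)" if t: "0 < t" "t \<le> 1" for t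
  proof -
    have "((\<lambda>t. H n t) has_real_derivative (- (1 / (2 * t)) * (\<Prod>i<n. 1 / (H i t + 1)))) (at t)"
      unfolding H_def by (rule hfun_sqrt_has_derivative[OF t])
    from DERIV_fun_powr[OF this, of "\<alpha> + 1"] H1[OF t, of n]
    have "((\<lambda>t. H n t powr (\<alpha> + 1)) has_real_derivative
        (\<alpha> + 1) * H n t powr \<alpha> * (- (1 / (2 * t)) * (\<Prod>i<n. 1 / (H i t + 1)))) (at t)"
      by simp
    from DERIV_cmult[OF this, of c] have "(G has_real_derivative
        c * ((\<alpha> + 1) * H n t powr \<alpha> * (- (1 / (2 * t)) * (\<Prod>i<n. 1 / (H i t + 1))))) (at t)"
      unfolding G_def[abs_def] .
    moreover have "c * ((\<alpha> + 1) * x * (- (1 / (2 * t)) * y)) = 2 ^ n * (1 / t) * x * y" for x y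
    proof -
      have "c * (\<alpha> + 1) = - (2 * 2 ^ n)"
        using \<alpha> by (simp add: c_def)
      then have "c * ((\<alpha> + 1) * x * (- (1 / (2 * t)) * y)) = - (2 * 2 ^ n) * x * (- (1 / (2 * t)) * y)"
        by (simp only: mult.assoc[symmetric])
      then show ?thesis using t by simp
    qed
    ultimately show ?thesis by (simp only: G'_def)
  qed
  have le: "\<phi> t \<le> G' t" if t: "0 < t" "t \<le> 1" for t
  proof -
    have "(\<Prod>i<n. inverse (H i t)) \<le> (\<Prod>i<n. 2 * (1 / (H i t + 1)))"
    proof (intro prod_mono conjI)
      fix i show "0 \<le> inverse (H i t)" "inverse (H i t) \<le> 2 * (1 / (H i t + 1))"
        using H1[OF t, of i] by (auto simp: field_simps)
    qed
    also have "\<dots> = 2 ^ n * (\<Prod>i<n. 1 / (H i t + 1))"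
      by (subst prod.distrib) simp
    finally have "t powr (-1) * H n t powr \<alpha> * (\<Prod>i<n. inverse (H i t)) \<le>
        t powr (-1) * H n t powr \<alpha> * (2 ^ n * (\<Prod>i<n. 1 / (H i t + 1)))"
      by (intro mult_left_mono) auto
    then show ?thesis
      using t unfolding \<phi>_def G'_def by (simp add: powr_minus_divide mult_ac)
  qed
  have G'0: "G' t \<ge> 0" if "0 < t" "t \<le> 1" for t
    unfolding G'_def using H1[OF that] that
    by (intro mult_nonneg_nonneg prod_nonneg) (auto intro: add_nonneg_nonneg order_trans[OF zero_le_one])
  \<comment> \<open>The primitive is differentiable only away from 0, so the integral is taken from
    1 / Suc m. The bound is uniform in \<open>m\<close> because \<open>G\<close> is nonnegative at
    the lower endpoint, and monotone convergence then reaches 0.\<close>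
  have part: "(\<integral>\<^sup>+t\<in>{1 / Suc m..1}. ennreal (\<phi> t) \<partial>lborel) \<le> ennreal (G 1)" for m :: nat
  proof -
    have pos: "t > 0" if "t \<ge> 1 / Suc m" for t :: real
      using that by (rule less_le_trans[rotated]) simp
    have "(\<integral>\<^sup>+t\<in>{1 / Suc m..1}. ennreal (\<phi> t) \<partial>lborel) \<le> (\<integral>\<^sup>+t\<in>{1 / Suc m..1}. ennreal (G' t) \<partial>lborel)"
      using le pos by (intro nn_integral_mono) (auto simp: indicator_def intro!: ennreal_leI)
    also have "\<dots> = ennreal (G 1 - G (1 / Suc m))"
      using G G'0 pos by (intro nn_integral_FTC_Icc) auto
    also have "\<dots> \<le> ennreal (G 1)"
      using c by (intro ennreal_leI) (simp add: G_def)
    finally show ?thesis .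
  qed
  have "(\<integral>\<^sup>+z\<in>ball 0 1. ennreal (f_weight \<alpha> (Suc n) z) \<partial>lborel)
      = (\<integral>\<^sup>+z. ennreal (\<phi> ((cmod z)\<^sup>2)) * indicator {..<1} ((cmod z)\<^sup>2) \<partial>lborel)"
  proof (intro nn_integral_cong)
    fix z :: complex
    have "(cmod z)\<^sup>2 powr (-1) = cmod z powr (-2)"
      by (cases "z = 0") (auto simp: powr_minus powr_numeral)
    then have "\<phi> ((cmod z)\<^sup>2) = f_weight \<alpha> (Suc n) z"
      unfolding \<phi>_def f_weight_Suc H_def by (simp add: hfun_cmod)
    then show "ennreal (f_weight \<alpha> (Suc n) z) * indicator (ball 0 1) z
        = ennreal (\<phi> ((cmod z)\<^sup>2)) * indicator {..<1} ((cmod z)\<^sup>2)"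
      by (auto simp: indicator_def abs_square_less_1)
  qed
  also have "\<dots> = ennreal pi * (\<integral>\<^sup>+t. ennreal (\<phi> t) * indicator {..<1} t * indicator {0..} t \<partial>lborel)"
    by (rule nn_integral_complex_radial) measurable
  also have "(\<integral>\<^sup>+t. ennreal (\<phi> t) * indicator {..<1} t * indicator {0..} t \<partial>lborel)
      \<le> (\<integral>\<^sup>+t. (SUP m. ennreal (\<phi> t) * indicator {1 / Suc m..1} t) \<partial>lborel)"
  proof (intro nn_integral_mono)
    fix t :: real
    show "ennreal (\<phi> t) * indicator {..<1} t * indicator {0..} t
        \<le> (SUP m. ennreal (\<phi> t) * indicator {1 / Suc m..1} t)"
    proof (cases "0 < t \<and> t < 1")
      case True
      then obtain m where "1 / Suc m < t" using nat_approx_posE by auto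
      with True show ?thesis
        by (intro SUP_upper2[of m]) auto
    next
      case False
      \<comment> \<open>At t = 0 the value of \<open>0 powr (-1)\<close> is 0, so that point
        contributes nothing.\<close>
      then have "\<phi> t = 0 \<or> \<not> (t < 1 \<and> t \<ge> 0)" by (auto simp: \<phi>_def)
      then show ?thesis by auto
    qed
  qed
  also have "\<dots> = (SUP m. (\<integral>\<^sup>+t\<in>{1 / Suc m..1}. ennreal (\<phi> t) \<partial>lborel))"
  proof (intro nn_integral_monotone_convergence_SUP)
    show "incseq (\<lambda>m t. ennreal (\<phi> t) * indicator {1 / real (Suc m)..1} t)"
    proof (intro incseq_SucI le_funI mult_left_mono)
      fix m t
      have "1 / real (Suc (Suc m)) \<le> 1 / real (Suc m)" by (intro divide_left_mono) auto
      then show "(indicator {1 / real (Suc m)..1} t :: ennreal) \<le> indicator {1 / real (Suc (Suc m))..1} t"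
        by (auto simp: indicator_def)
    qed simp
  qed measurable
  also have "\<dots> \<le> ennreal (G 1)"
    by (intro SUP_least part)
  finally have "(\<integral>\<^sup>+z\<in>ball 0 1. ennreal (f_weight \<alpha> (Suc n) z) \<partial>lborel) \<le> ennreal pi * ennreal (G 1)"
    by (simp add: mult_left_mono)
  also have "\<dots> < \<infinity>" by (simp add: ennreal_mult_less_top)
  finally show ?thesis .
qed

section \<open>Disc integrals with a density singular at the origin, and on discs of any
  radius\<close>

text \<open>The density \<open>k\<close> may blow up only at the origin, the other factors only at
  the unit circle, so the two singularities never meet. On the outer annulus \<open>k\<close> is
  bounded and the Forelli-Rudin estimate applies; on the inner disc the other factors are bounded
  uniformly in \<open>z\<close> and integrability of \<open>k\<close> is enough. The bound 4 is
  |w|^-2 at |w| = 1/2.\<close>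

lemma nn_integral_disc_weighted_le:
  fixes k :: "complex \<Rightarrow> real" and s :: real
  assumes s: "0 < s" "s < 1"
    and [measurable]: "k \<in> borel_measurable borel"
    and k: "\<And>w. 0 \<le> k w" "\<And>w. 1 / 2 \<le> cmod w \<Longrightarrow> cmod w < 1 \<Longrightarrow> k w \<le> 4"
    and fin: "(\<integral>\<^sup>+w\<in>ball 0 1. ennreal (k w) \<partial>lborel) < \<infinity>"
  obtains C where "C > 0" "\<And>z. cmod z < 1 \<Longrightarrow>
    (\<integral>\<^sup>+w\<in>ball 0 1. ennreal (k w * ((1 - (cmod w)\<^sup>2) powr (-s) / (cmod (1 - z * cnj w))\<^sup>2)) \<partial>lborel)
    \<le> ennreal (C * (1 - (cmod z)\<^sup>2) powr (-s))"
proof -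
  define B where "B = enn2real (\<integral>\<^sup>+w\<in>ball 0 1. ennreal (k w) \<partial>lborel)"
  have B: "(\<integral>\<^sup>+w\<in>ball 0 1. ennreal (k w) \<partial>lborel) = ennreal B" "B \<ge> 0"
    using fin by (auto simp: B_def less_top)
  define R where "R = 3 * pi * (1 / (1 - s) + 1 / s)"
  have R: "R > 0" using s by (auto simp: R_def intro!: mult_pos_pos add_pos_pos)
  have [measurable]: "cnj \<in> borel_measurable borel"
    by (intro borel_measurable_continuous_onI continuous_intros)
  show thesis
  proof (rule that)
    show "4 * R + 8 * B > 0" using R B by simp
  next
    fix z :: complex assume z: "cmod z < 1"
    define X where "X w = (1 - (cmod w)\<^sup>2) powr (-s) / (cmod (1 - z * cnj w))\<^sup>2" for w
    have [measurable]: "X \<in> borel_measurable borel" unfolding X_def[abs_def] by measurable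
    have X0: "X w \<ge> 0" for w by (simp add: X_def)
    \<comment> \<open>On the inner disc 1 - |w|^2 is at least 3/4, so its power is at most 4/3 and
      hence at most 2, and |1 - z * cnj w| is at least 1/2; this gives 8 = 2 / (1/2)^2.\<close>
    have pt: "k w * X w \<le> 4 * X w + 8 * k w" if w: "cmod w < 1" for w
    proof (cases "1 / 2 \<le> cmod w")
      case True
      have "k w * X w \<le> 4 * X w" using k(2)[OF True w] X0 by (intro mult_right_mono) auto
      then show ?thesis using k(1)[of w] by simp
    next
      case False
      have "(cmod w)\<^sup>2 \<le> (1 / 2)\<^sup>2" using False by (intro power_mono) auto
      then have w2: "3 / 4 \<le> 1 - (cmod w)\<^sup>2" by (simp add: power2_eq_square)
      have "(1 - (cmod w)\<^sup>2) powr (-s) \<le> (3 / 4) powr (-s)"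
        using w2 s by (intro powr_mono2') auto
      also have "\<dots> \<le> (3 / 4) powr (-1)" using s by (intro powr_mono') auto
      also have "\<dots> \<le> 2" by (simp add: powr_minus_divide)
      finally have n: "(1 - (cmod w)\<^sup>2) powr (-s) \<le> 2" .
      have "cmod (z * cnj w) \<le> 1 / 2"
        using False z mult_mono[of "cmod z" 1 "cmod w" "1 / 2"] by (simp add: norm_mult)
      then have "1 / 2 \<le> cmod (1 - z * cnj w)"
        using norm_triangle_ineq2[of 1 "z * cnj w"] by simp
      then have "(1 / 2)\<^sup>2 \<le> (cmod (1 - z * cnj w))\<^sup>2" by (intro power_mono) auto
      then have "X w \<le> 2 / (1 / 2)\<^sup>2"
        unfolding X_def using n by (intro frac_le) auto
      then have "X w \<le> 8" by (simp add: power2_eq_square)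
      then have "k w * X w \<le> k w * 8" using k(1) by (intro mult_left_mono) auto
      then show ?thesis using X0[of w] by simp
    qed
    \<comment> \<open>The contribution of the inner disc is a constant; it is absorbed into the
      claimed bound because the power of 1 - |z|^2 is at least 1.\<close>
    have "(1 - (cmod z)\<^sup>2) powr 0 \<le> (1 - (cmod z)\<^sup>2) powr (-s)"
      using z s by (intro powr_mono') (auto simp: abs_square_less_1 power_le_one)
    then have ge1: "1 \<le> (1 - (cmod z)\<^sup>2) powr (-s)"
      using z by (auto simp: abs_square_less_1 abs_square_eq_1)
    have "(\<integral>\<^sup>+w\<in>ball 0 1. ennreal (k w * X w) \<partial>lborel)
      \<le> (\<integral>\<^sup>+w. 4 * (ennreal (X w) * indicator (ball 0 1) w) + 8 * (ennreal (k w) * indicator (ball 0 1) w) \<partial>lborel)"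
    proof (intro nn_integral_mono)
      fix w
      have "ennreal (4 * X w + 8 * k w) = 4 * ennreal (X w) + 8 * ennreal (k w)"
        using X0 k(1) by (simp add: ennreal_plus ennreal_mult')
      then show "ennreal (k w * X w) * indicator (ball 0 1) w \<le>
        4 * (ennreal (X w) * indicator (ball 0 1) w) + 8 * (ennreal (k w) * indicator (ball 0 1) w)"
        using ennreal_leI[OF pt[of w]] by (auto simp: indicator_def)
    qed
    also have "\<dots> = 4 * (\<integral>\<^sup>+w\<in>ball 0 1. ennreal (X w) \<partial>lborel) + 8 * ennreal B"
      unfolding B(1)[symmetric] by (subst nn_integral_add) (simp_all add: nn_integral_cmult)
    also have "\<dots> \<le> 4 * ennreal (R * (1 - (cmod z)\<^sup>2) powr (-s)) + 8 * ennreal B"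
      using forelli_rudin_disc[OF s z]
      by (intro add_right_mono mult_left_mono) (auto simp: X_def R_def)
    also have "\<dots> = ennreal (4 * R * (1 - (cmod z)\<^sup>2) powr (-s) + 8 * B)"
      using R B by (simp add: ennreal_plus ennreal_mult' mult.assoc)
    also have "\<dots> \<le> ennreal ((4 * R + 8 * B) * (1 - (cmod z)\<^sup>2) powr (-s))"
      using mult_left_mono[OF ge1 B(2)] by (intro ennreal_leI) (simp add: algebra_simps)
    finally show "(\<integral>\<^sup>+w\<in>ball 0 1. ennreal (k w * ((1 - (cmod w)\<^sup>2) powr (-s) / (cmod (1 - z * cnj w))\<^sup>2)) \<partial>lborel)
        \<le> ennreal ((4 * R + 8 * B) * (1 - (cmod z)\<^sup>2) powr (-s))"
      by (simp add: X_def)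
  qed
qed

text \<open>This is the integral over \<open>w1\<close> for fixed w2 = b. Substituting w = |b| v
  gives the Jacobian |b|^2 and leaves the phase |b| / b, which moves into \<open>u\<close> without
  changing |u|.\<close>

lemma forelli_rudin_scaled_disc:
  fixes s :: real
  assumes s: "0 < s" "s < 1" and u: "cmod u < 1" and b: "b \<noteq> 0"
  shows "(\<integral>\<^sup>+w\<in>ball 0 (cmod b). ennreal ((1 - (cmod (w / b))\<^sup>2) powr (-s) / (cmod (1 - u * cnj (w / b)))\<^sup>2) \<partial>lborel)
    \<le> ennreal ((cmod b)\<^sup>2 * (3 * pi * (1 / (1 - s) + 1 / s) * (1 - (cmod u)\<^sup>2) powr (-s)))"
proof -
  define u' where "u' = u * cnj (of_real (cmod b) / b)"
  have u': "cmod u' = cmod u" using b by (simp add: u'_def norm_mult norm_divide)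
  have [measurable]: "cnj \<in> borel_measurable borel"
    by (intro borel_measurable_continuous_onI continuous_intros)
  have "(\<integral>\<^sup>+w\<in>ball 0 (cmod b). ennreal ((1 - (cmod (w / b))\<^sup>2) powr (-s) / (cmod (1 - u * cnj (w / b)))\<^sup>2) \<partial>lborel)
    = ennreal ((cmod b)\<^sup>2) * (\<integral>\<^sup>+v. ennreal ((1 - (cmod (of_real (cmod b) * v / b))\<^sup>2) powr (-s)
        / (cmod (1 - u * cnj (of_real (cmod b) * v / b)))\<^sup>2) * indicator (ball 0 (cmod b)) (of_real (cmod b) * v) \<partial>lborel)"
    using b by (intro nn_integral_complex_scale) auto
  also have "(\<integral>\<^sup>+v. ennreal ((1 - (cmod (of_real (cmod b) * v / b))\<^sup>2) powr (-s)
        / (cmod (1 - u * cnj (of_real (cmod b) * v / b)))\<^sup>2) * indicator (ball 0 (cmod b)) (of_real (cmod b) * v) \<partial>lborel)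
     = (\<integral>\<^sup>+v\<in>ball 0 1. ennreal ((1 - (cmod v)\<^sup>2) powr (-s) / (cmod (1 - u' * cnj v))\<^sup>2) \<partial>lborel)"
    using b by (intro nn_integral_cong) (auto simp: indicator_def norm_mult norm_divide u'_def mult.assoc)
  also have "\<dots> \<le> ennreal (3 * pi * (1 / (1 - s) + 1 / s) * (1 - (cmod u)\<^sup>2) powr (-s))"
    using forelli_rudin_disc[OF s, of u'] u u' by simp
  finally show ?thesis
    by (simp add: ennreal_mult' mult_left_mono)
qed

section \<open>The Hartogs triangle and its kernel\<close>

text \<open>This is the function \<open>A\<close> of the overview, one factor for each of the two
  disc coordinates.\<close>

definition hartogs_defect :: "complex \<times> complex \<Rightarrow> real" where
  "hartogs_defect z = (1 - (cmod (fst z / snd z))\<^sup>2) * (1 - (cmod (snd z))\<^sup>2)"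

lemma measurable_hartogs_defect [measurable]: "hartogs_defect \<in> borel_measurable borel"
  unfolding hartogs_defect_def[abs_def] by (simp add: borel_prod[symmetric])

lemma hartogs_sets [measurable]: "hartogs \<in> sets borel"
proof -
  have "hartogs = {z. cmod (fst z) < cmod (snd z)} \<inter> {z. cmod (snd z) < 1}"
    by (auto simp: hartogs_def)
  moreover have "open {z::complex \<times> complex. cmod (fst z) < cmod (snd z)}"
    "open {z::complex \<times> complex. cmod (snd z) < 1}"
    by (intro open_Collect_less continuous_intros)+
  ultimately show ?thesis by (metis borel_open open_Int)
qed

lemma hartogs_bounds:
  assumes "z \<in> hartogs"
  shows "snd z \<noteq> 0" "cmod (snd z) < 1" "cmod (fst z / snd z) < 1"
proof -
  have "0 < cmod (snd z)"
    using assms by (auto simp: hartogs_def intro: le_less_trans[OF norm_ge_zero])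
  then show "snd z \<noteq> 0" "cmod (snd z) < 1" "cmod (fst z / snd z) < 1"
    using assms by (auto simp: hartogs_def norm_divide)
qed

lemma hartogs_defect_pos: "z \<in> hartogs \<Longrightarrow> hartogs_defect z > 0"
  unfolding hartogs_defect_def using hartogs_bounds[of z]
  by (intro mult_pos_pos) (auto simp: abs_square_less_1)

text \<open>If \<open>z2\<close> or \<open>w2\<close> is 0, both sides are 0 because division by
  zero yields 0, so the product form holds at every point.\<close>

lemma cmod_hartogs_kernel:
  "cmod (hartogs_kernel (z1, z2) (w1, w2)) = 1 / (pi\<^sup>2 * cmod z2 * cmod w2) *
    (1 / (cmod (1 - z1 / z2 * cnj (w1 / w2)))\<^sup>2) * (1 / (cmod (1 - z2 * cnj w2))\<^sup>2)"
  by (simp add: hartogs_kernel_def norm_mult norm_divide norm_power)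

text \<open>Conjugation swaps the two points in each factor 1 - a * cnj b. Through this symmetry a
  single estimate covers both the rows and the columns of the Schur test.\<close>

lemma cmod_hartogs_kernel_commute:
  "cmod (hartogs_kernel z w) = cmod (hartogs_kernel w z)"
proof -
  have "cmod (1 - a * cnj b) = cmod (1 - b * cnj a)" for a b
    by (metis complex_cnj_cnj complex_cnj_diff complex_cnj_mult complex_cnj_one complex_mod_cnj mult.commute)
  note swap = this
  obtain z1 z2 w1 w2 where "z = (z1, z2)" "w = (w1, w2)" by (cases z, cases w)
  then show ?thesis
    using swap[of "z1 / z2" "w1 / w2"] swap[of z2 w2]
    by (simp only: cmod_hartogs_kernel mult.assoc mult.commute[of "cmod z2"])
qed

lemma measurable_hartogs_kernel [measurable]:
  "case_prod hartogs_kernel \<in> borel_measurable borel"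
proof -
  have *: "case_prod hartogs_kernel = (\<lambda>x. 1 / (complex_of_real (pi ^ 2) * snd (fst x) * cnj (snd (snd x))
    * (1 - (fst (fst x) * cnj (fst (snd x))) / (snd (fst x) * cnj (snd (snd x)))) ^ 2
          * (1 - snd (fst x) * cnj (snd (snd x))) ^ 2))"
    by (auto simp: hartogs_kernel_def)
  have [measurable]: "(\<lambda>x::(complex \<times> complex) \<times> complex \<times> complex. fst (fst x)) \<in> borel_measurable borel"
    "(\<lambda>x::(complex \<times> complex) \<times> complex \<times> complex. snd (fst x)) \<in> borel_measurable borel"
    "(\<lambda>x::(complex \<times> complex) \<times> complex \<times> complex. cnj (fst (snd x))) \<in> borel_measurable borel"
    "(\<lambda>x::(complex \<times> complex) \<times> complex \<times> complex. cnj (snd (snd x))) \<in> borel_measurable borel"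
    by (intro borel_measurable_continuous_onI continuous_intros)+
  show ?thesis unfolding * by measurable
qed

lemma measurable_hartogs_kernel_row [measurable]: "hartogs_kernel z \<in> borel_measurable borel"
proof -
  have "(\<lambda>w. (z, w)) \<in> borel_measurable borel"
    by (intro borel_measurable_continuous_onI continuous_intros)
  from measurable_compose[OF this measurable_hartogs_kernel] show ?thesis by simp
qed

text \<open>Integrate over \<open>w1\<close> first. The disc |w1| < |w2| yields |w2|^2, of which the
  kernel's 1 / |w2| consumes one power; what remains for the integral over \<open>w2\<close> is the
  density |w2| * m w2, which explains the hypotheses on \<open>m\<close>. The kernel's other factor
  1 / |z2| survives in the bound.\<close>

lemma hartogs_kernel_schur:
  fixes m :: "complex \<Rightarrow> real" and s :: real
  assumes s: "0 < s" "s < 1"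
    and [measurable]: "m \<in> borel_measurable borel"
    and m: "\<And>w. 0 \<le> m w" "\<And>w. 1 / 2 \<le> cmod w \<Longrightarrow> cmod w < 1 \<Longrightarrow> cmod w * m w \<le> 4"
    and fin: "(\<integral>\<^sup>+w\<in>ball 0 1. ennreal (cmod w * m w) \<partial>lborel) < \<infinity>"
  obtains C where "C > 0" "\<And>z. z \<in> hartogs \<Longrightarrow>
    (\<integral>\<^sup>+w\<in>hartogs. ennreal (cmod (hartogs_kernel z w)) * ennreal (m (snd w) * hartogs_defect w powr (-s)) \<partial>lborel)
    \<le> ennreal (C * (hartogs_defect z powr (-s) / cmod (snd z)))"
proof -
  obtain C where C: "C > 0" "\<And>z. cmod z < 1 \<Longrightarrow>
    (\<integral>\<^sup>+w\<in>ball 0 1. ennreal (cmod w * m w * ((1 - (cmod w)\<^sup>2) powr (-s) / (cmod (1 - z * cnj w))\<^sup>2)) \<partial>lborel)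
    \<le> ennreal (C * (1 - (cmod z)\<^sup>2) powr (-s))"
    by (rule nn_integral_disc_weighted_le[OF s, of "\<lambda>w. cmod w * m w"]) (use m fin in auto)
  define R where "R = 3 * pi * (1 / (1 - s) + 1 / s)"
  have R: "R > 0" using s by (auto simp: R_def intro!: mult_pos_pos add_pos_pos)
  have [measurable]: "cnj \<in> borel_measurable borel"
    by (intro borel_measurable_continuous_onI continuous_intros)
  show thesis
  proof (rule that)
    show "R * C / pi\<^sup>2 > 0" using R C by simp
  next
    fix z assume z: "z \<in> hartogs"
    obtain z1 z2 where zz: "z = (z1, z2)" by (cases z)
    define u where "u = z1 / z2"
    have z2: "z2 \<noteq> 0" "cmod z2 < 1" and u: "cmod u < 1"
      using hartogs_bounds[OF z] by (auto simp: zz u_def)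
    define Y where "Y w1 w2 = (1 - (cmod (w1 / w2))\<^sup>2) powr (-s) / (cmod (1 - u * cnj (w1 / w2)))\<^sup>2" for w1 w2
    define X where "X w = (1 - (cmod w)\<^sup>2) powr (-s) / (cmod (1 - z2 * cnj w))\<^sup>2" for w
    have [measurable]: "X \<in> borel_measurable borel" unfolding X_def[abs_def] by measurable
    have [measurable]: "(\<lambda>w1. Y w1 w2) \<in> borel_measurable borel" for w2
      unfolding Y_def[abs_def] by measurable
    \<comment> \<open>Here \<open>a\<close> collects what is constant in \<open>w2\<close> after the
      inner integration, and \<open>b\<close> below what is constant in \<open>w1\<close> before
      it.\<close>
    define a where "a = R * (1 - (cmod u)\<^sup>2) powr (-s) / (pi\<^sup>2 * cmod z2)"
    have a: "a \<ge> 0" using R z2 by (auto simp: a_def)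
    have inner: "(\<integral>\<^sup>+w1. ennreal (cmod (hartogs_kernel z (w1, w2))) *
          ennreal (m w2 * hartogs_defect (w1, w2) powr (-s)) * indicator hartogs (w1, w2) \<partial>lborel)
        \<le> ennreal a * (ennreal (cmod w2 * m w2 * X w2) * indicator (ball 0 1) w2)" for w2
    proof (cases "w2 \<noteq> 0 \<and> cmod w2 < 1")
      case True
      define b where "b = 1 / (pi\<^sup>2 * cmod z2 * cmod w2) * m w2 * X w2"
      have b: "b \<ge> 0" using m(1) by (auto simp: b_def X_def)
      have "(\<integral>\<^sup>+w1. ennreal (cmod (hartogs_kernel z (w1, w2))) *
          ennreal (m w2 * hartogs_defect (w1, w2) powr (-s)) * indicator hartogs (w1, w2) \<partial>lborel)
        = (\<integral>\<^sup>+w1. ennreal b * (ennreal (Y w1 w2) * indicator (ball 0 (cmod w2)) w1) \<partial>lborel)"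
      proof (intro nn_integral_cong)
        fix w1 :: complex
        show "ennreal (cmod (hartogs_kernel z (w1, w2))) *
          ennreal (m w2 * hartogs_defect (w1, w2) powr (-s)) * indicator hartogs (w1, w2)
          = ennreal b * (ennreal (Y w1 w2) * indicator (ball 0 (cmod w2)) w1)"
        proof (cases "cmod w1 < cmod w2")
          case w1: True
          have "hartogs_defect (w1, w2) powr (-s)
              = (1 - (cmod (w1 / w2))\<^sup>2) powr (-s) * (1 - (cmod w2)\<^sup>2) powr (-s)"
            unfolding hartogs_defect_def fst_conv snd_conv
            using True w1 by (intro powr_mult)
          then have "cmod (hartogs_kernel z (w1, w2)) * (m w2 * hartogs_defect (w1, w2) powr (-s)) = b * Y w1 w2"
            unfolding zz cmod_hartogs_kernel u_def[symmetric] b_def X_def Y_def by (simp add: field_simps)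
          then show ?thesis
            using w1 True b by (simp add: hartogs_def flip: ennreal_mult')
        qed (simp add: hartogs_def)
      qed
      also have "\<dots> = ennreal b * (\<integral>\<^sup>+w1\<in>ball 0 (cmod w2). ennreal (Y w1 w2) \<partial>lborel)"
        by (intro nn_integral_cmult) measurable
      also have "\<dots> \<le> ennreal b * ennreal ((cmod w2)\<^sup>2 * (R * (1 - (cmod u)\<^sup>2) powr (-s)))"
        unfolding Y_def R_def using True by (intro mult_left_mono forelli_rudin_scaled_disc[OF s u]) auto
      also have "\<dots> = ennreal (b * ((cmod w2)\<^sup>2 * (R * (1 - (cmod u)\<^sup>2) powr (-s))))"
        using b by (simp add: ennreal_mult')
      also have "b * ((cmod w2)\<^sup>2 * (R * (1 - (cmod u)\<^sup>2) powr (-s))) = a * (cmod w2 * m w2 * X w2)"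
        using True z2 by (simp add: b_def a_def power2_eq_square mult_ac)
      finally show ?thesis using True a by (simp add: ennreal_mult')
    qed (auto simp: hartogs_def)
    let ?f = "\<lambda>w. ennreal (cmod (hartogs_kernel z w)) *
          ennreal (m (snd w) * hartogs_defect w powr (-s)) * indicator hartogs w"
    have [measurable]: "snd \<in> borel_measurable (borel :: (complex \<times> complex) measure)"
      by (intro borel_measurable_continuous_onI continuous_intros)
    have "?f \<in> borel_measurable borel" by measurable
    then have f: "?f \<in> borel_measurable (lborel \<Otimes>\<^sub>M lborel)"
      unfolding lborel_prod by simp
    have "(\<integral>\<^sup>+w. ?f w \<partial>lborel) = (\<integral>\<^sup>+w2. (\<integral>\<^sup>+w1. ?f (w1, w2) \<partial>lborel) \<partial>lborel)"
      unfolding lborel_prod[symmetric] by (rule lborel_pair.nn_integral_snd[OF f, symmetric])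
    also have "\<dots> \<le> (\<integral>\<^sup>+w2. ennreal a * (ennreal (cmod w2 * m w2 * X w2) * indicator (ball 0 1) w2) \<partial>lborel)"
      using inner by (intro nn_integral_mono) simp
    also have "\<dots> = ennreal a * (\<integral>\<^sup>+w2\<in>ball 0 1. ennreal (cmod w2 * m w2 * X w2) \<partial>lborel)"
      by (intro nn_integral_cmult) measurable
    also have "\<dots> \<le> ennreal a * ennreal (C * (1 - (cmod z2)\<^sup>2) powr (-s))"
      unfolding X_def by (intro mult_left_mono C z2) auto
    also have "\<dots> = ennreal (a * (C * (1 - (cmod z2)\<^sup>2) powr (-s)))"
      using a by (simp add: ennreal_mult')
    also have "a * (C * (1 - (cmod z2)\<^sup>2) powr (-s)) = R * C / pi\<^sup>2 * (hartogs_defect z powr (-s) / cmod (snd z))"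
    proof -
      have "hartogs_defect z powr (-s) = (1 - (cmod u)\<^sup>2) powr (-s) * (1 - (cmod z2)\<^sup>2) powr (-s)"
        unfolding hartogs_defect_def zz u_def fst_conv snd_conv by (rule powr_mult)
      then show ?thesis
        by (simp add: a_def zz)
    qed
    finally show "(\<integral>\<^sup>+w\<in>hartogs. ennreal (cmod (hartogs_kernel z w)) *
        ennreal (m (snd w) * hartogs_defect w powr (-s)) \<partial>lborel)
      \<le> ennreal (R * C / pi\<^sup>2 * (hartogs_defect z powr (-s) / cmod (snd z)))" .
  qed
qed

section \<open>The two test functions and the estimate for the projection\<close>

theorem theorem4p9:
  fixes j :: nat and \<alpha> :: real
  assumes "j \<ge> 1" and "\<alpha> < -1"
  shows "\<exists>C>0. \<forall>(f :: complex \<times> complex \<Rightarrow> complex) (lam::real).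
           f \<in> borel_measurable lebesgue
           \<longrightarrow> (\<integral>\<^sup>+ w\<in>hartogs. ennreal (cmod (f w) powr (4/3) * mu_weight \<alpha> j w) \<partial>lebesgue) < \<infinity>
           \<longrightarrow> lam > 0
           \<longrightarrow> emeasure lebesgue {z \<in> hartogs. cmod (bergman_proj f z) > lam}
               \<le> ennreal (C / lam powr (4/3))
                  * (\<integral>\<^sup>+ w\<in>hartogs. ennreal (cmod (f w) powr (4/3) * mu_weight \<alpha> j w) \<partial>lebesgue)"
proof -
  have "f_weight \<alpha> j = f_weight \<alpha> (Suc (j - 1))" using assms by simp
  note fin = nn_integral_f_weight_finite[OF assms(2), of "j - 1", folded this]
  have bound4: "f_weight \<alpha> j w \<le> 4" if w: "1 / 2 \<le> cmod w" "cmod w < 1" for w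
  proof -
    have "f_weight \<alpha> j w \<le> cmod w powr (-2)"
      using w assms by (intro f_weight_le) auto
    also have "\<dots> \<le> (1 / 2) powr (-2)" using w by (intro powr_mono2') auto
    also have "\<dots> = 4" by (simp add: powr_minus power2_eq_square)
    finally show ?thesis .
  qed
  \<comment> \<open>The division by |w| makes |w| * m w equal to \<open>f_weight\<close> on the
    disc. The cutoff keeps \<open>m\<close> nonnegative everywhere, as the logarithms may become
    negative outside the disc.\<close>
  define m where "m w = (if cmod w < 1 then f_weight \<alpha> j w / cmod w else 0)" for w
  have [measurable]: "m \<in> borel_measurable borel" unfolding m_def[abs_def] by measurable
  have m_nonneg: "m w \<ge> 0" for w
    using f_weight_pos[of w \<alpha> j] by (cases "w = 0") (auto simp: m_def)
  have m: "cmod w * m w = f_weight \<alpha> j w" if "cmod w < 1" for w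
    using that by (cases "w = 0") (auto simp: m_def f_weight_def)
  have fin_m: "(\<integral>\<^sup>+w\<in>ball 0 1. ennreal (cmod w * m w) \<partial>lborel) < \<infinity>"
  proof -
    have "(\<integral>\<^sup>+w\<in>ball 0 1. ennreal (cmod w * m w) \<partial>lborel)
        = (\<integral>\<^sup>+w\<in>ball 0 1. ennreal (f_weight \<alpha> j w) \<partial>lborel)"
      by (intro nn_integral_cong) (auto simp: m indicator_def)
    with fin show ?thesis by simp
  qed
  obtain C1 where C1: "C1 > 0" "\<And>z. z \<in> hartogs \<Longrightarrow>
    (\<integral>\<^sup>+w\<in>hartogs. ennreal (cmod (hartogs_kernel z w)) * ennreal (m (snd w) * hartogs_defect w powr (-(1/2))) \<partial>lborel)
    \<le> ennreal (C1 * (hartogs_defect z powr (-(1/2)) / cmod (snd z)))"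
    by (rule hartogs_kernel_schur[of "1/2" m]) (use m_nonneg m bound4 fin_m in auto)
  \<comment> \<open>This is the power of |z2| in \<open>\<beta> powr (1/3)\<close>; correspondingly
    the exponent -1/2 of the defect becomes -1/6 in the second application.\<close>
  define m' where "m' w = cmod w powr (-(1/3))" for w
  have [measurable]: "m' \<in> borel_measurable borel" unfolding m'_def[abs_def] by measurable
  have m': "cmod w * m' w \<le> 1" if "cmod w < 1" for w
  proof (cases "w = 0")
    case False
    then have "cmod w * m' w = cmod w powr 1 * cmod w powr (-(1/3))" by (simp add: m'_def)
    also have "\<dots> = cmod w powr (2/3)" by (subst powr_add[symmetric]) simp
    also have "\<dots> \<le> 1" using that by (intro powr_le1) auto
    finally show ?thesis .
  qed simp
  have fin_m': "(\<integral>\<^sup>+w\<in>ball 0 1. ennreal (cmod w * m' w) \<partial>lborel) < \<infinity>"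
  proof -
    have "(\<integral>\<^sup>+w\<in>ball 0 1. ennreal (cmod w * m' w) \<partial>lborel) \<le> (\<integral>\<^sup>+w. indicator (ball 0 1) w \<partial>(lborel :: complex measure))"
      using m' by (intro nn_integral_mono) (auto simp: indicator_def)
    also have "\<dots> < \<infinity>" by (simp add: emeasure_ball)
    finally show ?thesis .
  qed
  obtain C2 where C2: "C2 > 0" "\<And>z. z \<in> hartogs \<Longrightarrow>
    (\<integral>\<^sup>+w\<in>hartogs. ennreal (cmod (hartogs_kernel z w)) * ennreal (m' (snd w) * hartogs_defect w powr (-(1/6))) \<partial>lborel)
    \<le> ennreal (C2 * (hartogs_defect z powr (-(1/6)) / cmod (snd z)))"
    by (rule hartogs_kernel_schur[of "1/6" m']) (use m' fin_m' in \<open>force simp: m'_def\<close>)+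
  define P where "P w = m (snd w) * hartogs_defect w powr (-(1/2))" for w
  define \<beta> where "\<beta> z = hartogs_defect z powr (-(1/2)) / cmod (snd z)" for z
  define K where "K z w = ennreal (cmod (hartogs_kernel z w))" for z w
  have [measurable]: "snd \<in> borel_measurable (borel :: (complex \<times> complex) measure)"
    by (intro borel_measurable_continuous_onI continuous_intros)
  have [measurable]: "P \<in> borel_measurable borel" "\<beta> \<in> borel_measurable borel" "mu_weight \<alpha> j \<in> borel_measurable borel"
    unfolding P_def[abs_def] \<beta>_def[abs_def] mu_weight_def[abs_def] by measurable
  have K: "case_prod K \<in> borel_measurable (lborel \<Otimes>\<^sub>M lborel)"
  proof -
    have "case_prod K = (\<lambda>x. ennreal (cmod (case_prod hartogs_kernel x)))"
      by (auto simp: K_def)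
    then show ?thesis
      unfolding lborel_prod by simp
  qed
  have P_pos: "P z > 0" if "z \<in> hartogs" for z
    using hartogs_bounds[OF that] hartogs_defect_pos[OF that] f_weight_pos[of "snd z" \<alpha> j]
    by (auto simp: P_def m_def)
  have \<beta>_pos: "\<beta> z > 0" if "z \<in> hartogs" for z
    using hartogs_bounds[OF that] hartogs_defect_pos[OF that] by (auto simp: \<beta>_def)
  have \<beta>_powr: "\<beta> z powr (4/3 - 1) = m' (snd z) * hartogs_defect z powr (-(1/6))" for z
    by (simp add: \<beta>_def m'_def powr_mult powr_divide powr_powr powr_minus field_simps)
  \<comment> \<open>The left side is what the kernel estimate returns for
    \<open>\<beta> powr (1/3)\<close>; the right side is what the Schur test requires. In
    \<open>mu_weight\<close> times \<open>P powr (1/3)\<close> the powers of \<open>f_weight\<close>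
    cancel, and those of |w2| add up to -1.\<close>
  have \<mu>P: "hartogs_defect w powr (-(1/6)) / cmod (snd w) = mu_weight \<alpha> j w * P w powr (4/3 - 1)"
    if w: "w \<in> hartogs" for w
  proof -
    define r where "r = cmod (snd w)"
    define f where "f = f_weight \<alpha> j (snd w)"
    define d where "d = hartogs_defect w"
    have pos: "r > 0" "f > 0" "d > 0" "r < 1"
      using hartogs_bounds[OF w] hartogs_defect_pos[OF w] f_weight_pos[of "snd w" \<alpha> j]
      by (auto simp: r_def f_def d_def)
    have "(r\<^sup>2 * f) powr (-1/3) * (f / r * d powr (-(1/2))) powr (1/3) = d powr (-(1/6)) / r"
    proof -
      have r2: "r\<^sup>2 = r powr 2" using pos by simp
      have "(r\<^sup>2 * f) powr (-1/3) = r powr (-(2/3)) * f powr (-(1/3))"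
        unfolding r2 powr_mult powr_powr by simp
      moreover have "(f / r * d powr (-(1/2))) powr (1/3) = f powr (1/3) * r powr (-(1/3)) * d powr (-(1/6))"
        unfolding powr_mult powr_divide powr_powr by (simp add: powr_minus_divide)
      moreover have "f powr (-(1/3)) * f powr (1/3) = 1"
        using pos by (subst powr_add[symmetric]) simp
      moreover have "r powr (-(2/3)) * r powr (-(1/3)) = 1 / r"
        using pos by (subst powr_add[symmetric]) (simp add: powr_minus_divide)
      moreover have "a * b * (c * e * g) = (a * e) * (b * c) * g" for a b c e g :: real
        by (simp only: mult_ac)
      ultimately have "(r\<^sup>2 * f) powr (-1/3) * (f / r * d powr (-(1/2))) powr (1/3)
          = 1 / r * 1 * d powr (-(1/6))"
        by (simp only:)
      then show ?thesis by simp
    qed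
    then show ?thesis
      using pos by (simp add: mu_weight_def P_def m_def r_def f_def d_def)
  qed
  have row: "(\<integral>\<^sup>+w\<in>hartogs. K z w * ennreal (P w) \<partial>lborel) \<le> ennreal (C1 * \<beta> z)" if "z \<in> hartogs" for z
    using C1(2)[OF that] unfolding K_def P_def \<beta>_def .
  have col: "(\<integral>\<^sup>+z\<in>hartogs. K z w * ennreal (\<beta> z powr (4/3 - 1)) \<partial>lborel)
                  \<le> ennreal (C2 * mu_weight \<alpha> j w * P w powr (4/3 - 1))" if "w \<in> hartogs" for w
    using C2(2)[OF that] unfolding \<mu>P[OF that] \<beta>_powr K_def
    by (subst cmod_hartogs_kernel_commute) (simp add: mult.assoc)
  define C where "C = 2 powr (4/3) * C1 powr (4/3 - 1) * C2"
  show ?thesis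
  proof (intro exI[of _ C] conjI allI impI)
    show "C > 0" using C1 C2 by (simp add: C_def)
  next
    fix f :: "complex \<times> complex \<Rightarrow> complex" and lam :: real
    assume f: "f \<in> borel_measurable lebesgue" and lam: "lam > 0"
    \<comment> \<open>Since \<open>f\<close> is only Lebesgue measurable, |f| is replaced by a Borel
      function that agrees with it almost everywhere. On the exceptional null set this function may
      be negative, hence the absolute values around \<open>F\<close>.\<close>
    have "(\<lambda>w. cmod (f w)) \<in> borel_measurable lebesgue" using f by measurable
    from completion_ex_borel_measurable_real[OF this]
    obtain F where [measurable]: "F \<in> borel_measurable lborel" and F: "AE w in lborel. cmod (f w) = F w"
      by auto
    have schur: "emeasure lborel {z\<in>hartogs. (\<integral>\<^sup>+w\<in>hartogs. K z w * ennreal \<bar>F w\<bar> \<partial>lborel) > ennreal lam}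
        \<le> ennreal (2 powr (4/3) * C1 powr (4/3 - 1) * C2 / lam powr (4/3)) *
          (\<integral>\<^sup>+w\<in>hartogs. ennreal (\<bar>F w\<bar> powr (4/3) * mu_weight \<alpha> j w) \<partial>lborel)"
    proof (rule weak_type_schur[where P = P and \<beta> = \<beta>])
      show "sigma_finite_measure (lborel :: (complex \<times> complex) measure)"
        by (rule lborel.sigma_finite_measure_axioms)
      show "0 \<le> mu_weight \<alpha> j z" for z by (simp add: mu_weight_def)
    qed (rule row col P_pos \<beta>_pos K lam C1(1) less_imp_le[OF C2(1)] | assumption | simp)+
    have norm_eq: "(\<integral>\<^sup>+w\<in>hartogs. ennreal (\<bar>F w\<bar> powr (4/3) * mu_weight \<alpha> j w) \<partial>lborel)
        = (\<integral>\<^sup>+w\<in>hartogs. ennreal (cmod (f w) powr (4/3) * mu_weight \<alpha> j w) \<partial>lebesgue)"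
      unfolding nn_integral_completion
      by (intro nn_integral_cong_AE) (use F in \<open>eventually_elim; metis abs_norm_cancel\<close>)
    have le: "ennreal (cmod (bergman_proj f z)) \<le> (\<integral>\<^sup>+w\<in>hartogs. K z w * ennreal \<bar>F w\<bar> \<partial>lborel)" for z
    proof (cases "set_integrable lebesgue hartogs (\<lambda>w. hartogs_kernel z w * f w)")
      case True
      then have "ennreal (cmod (bergman_proj f z)) \<le>
          (\<integral>\<^sup>+w. ennreal (cmod (indicat_real hartogs w *\<^sub>R (hartogs_kernel z w * f w))) \<partial>lebesgue)"
        unfolding bergman_proj_def set_lebesgue_integral_def set_integrable_def
        by (rule integral_norm_bound_ennreal)
      also have "\<dots> = (\<integral>\<^sup>+w\<in>hartogs. K z w * ennreal \<bar>F w\<bar> \<partial>lborel)"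
        unfolding nn_integral_completion
      proof (rule nn_integral_cong_AE, use F in eventually_elim)
        case (elim w)
        then have "\<bar>F w\<bar> = cmod (f w)" by (metis abs_norm_cancel)
        then show ?case
          by (auto simp: K_def norm_mult indicator_def ennreal_mult')
      qed
      finally show ?thesis .
    next
      \<comment> \<open>The Bochner integral of a non-integrable function is 0 by convention, so the
        pointwise bound holds at every \<open>z\<close>.\<close>
      case False
      then have "bergman_proj f z = 0"
        unfolding bergman_proj_def set_lebesgue_integral_def set_integrable_def
        by (rule not_integrable_integral_eq)
      then show ?thesis by simp
    qed
    let ?A = "{z\<in>hartogs. (\<integral>\<^sup>+w\<in>hartogs. K z w * ennreal \<bar>F w\<bar> \<partial>lborel) > ennreal lam}"
    \<comment> \<open>Monotonicity of \<open>emeasure\<close> asks for measurability of the larger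
      set. Here it comes from Tonelli's theorem for the Borel function \<open>F\<close>, so that of
      the level set of \<open>bergman_proj f\<close> is never invoked.\<close>
    have A: "?A \<in> sets lborel"
    proof -
      have "(\<lambda>w. ennreal \<bar>F w\<bar> * indicator hartogs w) \<in> borel_measurable lborel"
        by measurable
      from measurable_compose[OF measurable_snd this]
      have "(\<lambda>x. case_prod K x * (ennreal \<bar>F (snd x)\<bar> * indicator hartogs (snd x)))
          \<in> borel_measurable (lborel \<Otimes>\<^sub>M lborel)"
        by (rule borel_measurable_times_ennreal[OF K])
      from lborel.borel_measurable_nn_integral_fst[OF this]
      have [measurable]: "(\<lambda>z. \<integral>\<^sup>+w. K z w * ennreal \<bar>F w\<bar> * indicator hartogs w \<partial>lborel)
          \<in> borel_measurable lborel"
        by (simp add: mult.assoc)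
      show ?thesis by measurable
    qed
    have "emeasure lebesgue {z \<in> hartogs. cmod (bergman_proj f z) > lam} \<le> emeasure lebesgue ?A"
    proof (rule emeasure_mono)
      have "ennreal lam < (\<integral>\<^sup>+w\<in>hartogs. K z w * ennreal \<bar>F w\<bar> \<partial>lborel)"
        if "lam < cmod (bergman_proj f z)" for z
        using that lam by (intro less_le_trans[OF _ le[of z]] ennreal_lessI) auto
      then show "{z \<in> hartogs. cmod (bergman_proj f z) > lam} \<subseteq> ?A" by auto
      show "?A \<in> sets lebesgue" using A by simp
    qed
    also have "\<dots> = emeasure lborel ?A" using A by simp
    also have "\<dots> \<le> ennreal (C / lam powr (4/3)) *
        (\<integral>\<^sup>+ w\<in>hartogs. ennreal (cmod (f w) powr (4/3) * mu_weight \<alpha> j w) \<partial>lebesgue)"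
      using schur unfolding norm_eq C_def .
    finally show "emeasure lebesgue {z \<in> hartogs. cmod (bergman_proj f z) > lam} \<le> ennreal (C / lam powr (4/3)) *
        (\<integral>\<^sup>+ w\<in>hartogs. ennreal (cmod (f w) powr (4/3) * mu_weight \<alpha> j w) \<partial>lebesgue)" .
  qed
qed

end
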